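(* Let $d\ge2$. (i) Let the Schrödinger operator $H=\Delta+Q$, with a real $\mathbb Z^d$-periodic potential $Q$, act on a loop graph $\Gamma$ with loop fundamental graph $\Gamma_f$ having $\nu$ vertices. Then the spectral bands $\sigma_n=\sigma_n(H)=[\lambda_n^-,\lambda_n^+]$ satisfy $$\lambda_n^-=\lambda_n(0),\qquad n=1,\ldots,\nu.$$ (ii) Let, in addition, $\Gamma$ be precise with a precise quasimomentum $\vartheta_0\in\mathbb T^d$. Then $$\sigma_n=[\lambda_n^-,\lambda_n^+]=[\lambda_n(0),\lambda_n(\vartheta_0)],\quad n=1,\ldots,\nu,\qquad\text{and}\qquad \sum_{n=1}^\nu|\sigma_n|=2\beta,$$ where $\beta$ is the number of bridge-loops on the loop fundamental graph $\Gamma_f$. In particular, if all bridges of $\Gamma_f$ have the form $(v_k,v_k)$ for some vertex $v_k\in V_f$, then $$|\sigma(H)|=\sum_{n=1}^\nu|\sigma_n|=2\beta .$$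
   Context: A $\mathbb Z^d$-periodic graph $\Gamma=(V,\mathcal E)$ ($d\ge2$) is a connected graph embedded in $\mathbb R^d$, possibly with loops and multiple edges, with vertex set $V$ and set $\mathcal E$ of unoriented edges, such that: any bounded domain of $\mathbb R^d$ contains finitely many vertices; every vertex has finite degree (number of incident edges, a loop counted twice); and there is a basis $a_1,\ldots,a_d$ of $\mathbb R^d$ (the periods) with $\Gamma+a_s=\Gamma$ for $s=1,\ldots,d$. Coordinates are taken with some origin and axes along $a_1,\ldots,a_d$, so that $\Gamma+m=\Gamma$ for all $m\in\mathbb Z^d$. Each unoriented edge gives two oriented edges $(u,v)$ and $(v,u)$ (an unoriented loop gives two oriented loops); $\mathcal A$ is the set of oriented edges. The fundamental graph is $\Gamma_f=\Gamma/\mathbb Z^d$; it is finite, its vertex set $V_f$ is identified with $V\cap[0,1)^d=\{v_1,\ldots,v_\nu\}$, and $\mathcal A_f=\mathcal A/\mathbb Z^d$ is its set of oriented edges. Every $v\in V$ is uniquely $v=[v]+\tilde v$ with $[v]\in\mathbb Z^d$, $\tilde v\in V\cap[0,1)^d$. The index of $\mathbf e=(u,v)\in\mathcal A$ is $\tau(\mathbf e)=[v]-[u]\in\mathbb Z^d$; it is $\mathbb Z^d$-translation invariant and defines the index of the corresponding edge of $\mathcal A_f$. Edges of $\mathcal A_f$ with nonzero index are called bridges; $\mathcal B_f\subset\mathcal A_f$ is the set of bridges; bridges are counted as oriented edges, $\beta=\#\mathcal B_f$. A periodic graph $\Gamma$ is called a loop graph if all bridges of some fundamental graph $\Gamma_f$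 (for some choice of periods and origin) are loops; this $\Gamma_f$ is called a loop fundamental graph, and all coordinates, indices and Floquet matrices are taken with respect to it. A loop graph is called precise if $\cos\langle\tau(\mathbf e),\vartheta_0\rangle=-1$ for all $\mathbf e\in\mathcal B_f$ and some $\vartheta_0\in\mathbb T^d$, called a precise quasimomentum. $(\Delta f)(v)=\sum_{(v,u)_e\in\mathcal E}(f(v)-f(u))$ on $\ell^2(V)$; $Q$ is multiplication by a real function with $Q(v+m)=Q(v)$, $m\in\mathbb Z^d$; $q_j=Q(v_j)$. The Floquet matrices, for $\vartheta\in\mathbb T^d=\mathbb R^d/(2\pi\mathbb Z)^d$, are $H(\vartheta)=\Delta(\vartheta)+\mathrm{diag}(q_1,\ldots,q_\nu)$, $\Delta_{jk}(\vartheta)=\varkappa_j\delta_{jk}-\sum_{\mathbf e=(v_j,v_k)\in\mathcal A_f}e^{i\langle\tau(\mathbf e),\vartheta\rangle}$, $\varkappa_j=\deg v_j$. The eigenvalues of $H(\vartheta)$ are $\lambda_1(\vartheta)\le\ldots\le\lambda_\nu(\vartheta)$ (with multiplicity), the spectral bands are $\sigma_n(H)=[\lambda_n^-,\lambda_n^+]=\lambda_n(\mathbb T^d)$, and $\sigma(H)=\bigcup_n\sigma_n(H)$. $|\cdot|$ of a set is Lebesgue measure. *)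

theory Defs
  imports
    "HOL-Analysis.Analysis"
    "Jordan_Normal_Form.Char_Poly"
begin

(* From here on, $ is the component selector of real ^ 'd and int ^ 'd. *)
no_notation Matrix.vec_index (infixl "$" 100)

section \<open>Periodic graphs in Euclidean space\<close>

text \<open>
  A graph \<open>(V, E)\<close> is drawn in \<open>real ^ 'd\<close>: \<open>V\<close> is a set of points, and an unoriented edge is the
  point set of a curve that joins its end points and contains no other vertex. A \<^const>\<open>simple_path\<close>
  may be closed, which gives the loops; its end points need not be listed separately, since they
  are \<open>e \<inter> V\<close>, a singleton exactly when \<open>e\<close> is a loop. Multiple edges are distinct curves with the
  same end points. Distinct edges are allowed to cross outside \<open>V\<close>, so that for \<open>CARD('d) = 2\<close>
  the graph need not be planar.
\<close>

definition edge_curve :: "(real ^ 'd) set \<Rightarrow> (real ^ 'd) set \<Rightarrow> bool" where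
  "edge_curve V e \<longleftrightarrow>
     (\<exists>g. simple_path g \<and> path_image g = e \<and> e \<inter> V = {pathstart g, pathfinish g})"

definition adjacent :: "(real ^ 'd) set \<Rightarrow> (real ^ 'd) set set \<Rightarrow> ((real ^ 'd) \<times> (real ^ 'd)) set" where
  "adjacent V E = {(u, w). \<exists>e\<in>E. e \<inter> V = {u, w}}"

definition degree_at :: "(real ^ 'd) set \<Rightarrow> (real ^ 'd) set set \<Rightarrow> real ^ 'd \<Rightarrow> nat" where
  "degree_at V E v = card {e \<in> E. v \<in> e} + card {e \<in> E. e \<inter> V = {v}}"

definition is_periods :: "(real ^ 'd) set \<Rightarrow> (real ^ 'd) set set \<Rightarrow> ('d \<Rightarrow> real ^ 'd) \<Rightarrow> bool" where
  "is_periods V E a \<longleftrightarrow>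
     inj a \<and> independent (range a) \<and> span (range a) = UNIV \<and>
     (\<forall>s. (\<lambda>x. x + a s) ` V = V \<and> (\<lambda>e. (\<lambda>x. x + a s) ` e) ` E = E)"

definition periodic_graph :: "(real ^ 'd) set \<Rightarrow> (real ^ 'd) set set \<Rightarrow> ('d \<Rightarrow> real ^ 'd) \<Rightarrow> bool" where
  "periodic_graph V E a \<longleftrightarrow>
     V \<noteq> {} \<and>
     (\<forall>e\<in>E. edge_curve V e) \<and>
     (\<forall>u\<in>V. \<forall>w\<in>V. (u, w) \<in> (adjacent V E)\<^sup>*) \<and>
     (\<forall>S. bounded S \<longrightarrow> finite (V \<inter> S)) \<and>
     (\<forall>v\<in>V. finite {e \<in> E. v \<in> e}) \<and>
     is_periods V E a"

section \<open>Fundamental graph, indices and bridges\<close>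

definition lattice_vec :: "('d \<Rightarrow> real ^ 'd) \<Rightarrow> int ^ 'd \<Rightarrow> real ^ 'd" where
  "lattice_vec a m = (\<Sum>s\<in>UNIV. of_int (m $ s) *\<^sub>R a s)"

text \<open>Coordinates with respect to the origin \<open>orig\<close> and the axes \<open>a s\<close>.\<close>

definition coords :: "('d \<Rightarrow> real ^ 'd) \<Rightarrow> real ^ 'd \<Rightarrow> real ^ 'd \<Rightarrow> real ^ 'd" where
  "coords a orig x = (THE c. x = orig + (\<Sum>s\<in>UNIV. (c $ s) *\<^sub>R a s))"

definition int_part :: "('d \<Rightarrow> real ^ 'd) \<Rightarrow> real ^ 'd \<Rightarrow> real ^ 'd \<Rightarrow> int ^ 'd" where
  "int_part a orig x = (\<chi> s. \<lfloor>coords a orig x $ s\<rfloor>)"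

definition frac_part :: "('d \<Rightarrow> real ^ 'd) \<Rightarrow> real ^ 'd \<Rightarrow> real ^ 'd \<Rightarrow> real ^ 'd" where
  "frac_part a orig x = x - lattice_vec a (int_part a orig x)"

definition fund_verts :: "(real ^ 'd) set \<Rightarrow> ('d \<Rightarrow> real ^ 'd) \<Rightarrow> real ^ 'd \<Rightarrow> (real ^ 'd) set" where
  "fund_verts V a orig = {v \<in> V. \<forall>s. coords a orig v $ s \<in> {0..<1}}"

text \<open>
  An oriented edge is \<open>(e, u, w, b)\<close> with underlying edge \<open>e\<close>, initial vertex \<open>u\<close> and terminal
  vertex \<open>w\<close>. The flag \<open>b\<close> tells the two orientations of a loop apart; it is \<^const>\<open>False\<close> for the
  other edges, whose orientation is determined by \<open>u\<close> and \<open>w\<close>.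
\<close>

type_synonym 'd oedge = "(real ^ 'd) set \<times> (real ^ 'd) \<times> (real ^ 'd) \<times> bool"

definition oedges :: "(real ^ 'd) set \<Rightarrow> (real ^ 'd) set set \<Rightarrow> 'd oedge set" where
  "oedges V E = {(e, u, w, b). e \<in> E \<and> e \<inter> V = {u, w} \<and> (b \<longrightarrow> u = w)}"

fun osrc :: "'d oedge \<Rightarrow> real ^ 'd" where
  "osrc (e, u, w, b) = u"

fun otgt :: "'d oedge \<Rightarrow> real ^ 'd" where
  "otgt (e, u, w, b) = w"

fun otranslate :: "real ^ 'd \<Rightarrow> 'd oedge \<Rightarrow> 'd oedge" where
  "otranslate t (e, u, w, b) = ((\<lambda>x. x + t) ` e, u + t, w + t, b)"

definition oindex :: "('d \<Rightarrow> real ^ 'd) \<Rightarrow> real ^ 'd \<Rightarrow> 'd oedge \<Rightarrow> int ^ 'd" where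
  "oindex a orig x = int_part a orig (otgt x) - int_part a orig (osrc x)"

text \<open>
  The oriented edges of the fundamental graph are the lattice orbits of oriented edges. On an
  orbit, the index and the representatives in \<^const>\<open>fund_verts\<close> of the two end points are constant.
\<close>

definition oorbit :: "('d \<Rightarrow> real ^ 'd) \<Rightarrow> 'd oedge \<Rightarrow> 'd oedge set" where
  "oorbit a x = range (\<lambda>m. otranslate (lattice_vec a m) x)"

definition fund_oedges ::
  "(real ^ 'd) set \<Rightarrow> (real ^ 'd) set set \<Rightarrow> ('d \<Rightarrow> real ^ 'd) \<Rightarrow> 'd oedge set set" where
  "fund_oedges V E a = oorbit a ` oedges V E"

definition fsrc :: "('d \<Rightarrow> real ^ 'd) \<Rightarrow> real ^ 'd \<Rightarrow> 'd oedge set \<Rightarrow> real ^ 'd" where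
  "fsrc a orig c = the_elem ((\<lambda>x. frac_part a orig (osrc x)) ` c)"

definition ftgt :: "('d \<Rightarrow> real ^ 'd) \<Rightarrow> real ^ 'd \<Rightarrow> 'd oedge set \<Rightarrow> real ^ 'd" where
  "ftgt a orig c = the_elem ((\<lambda>x. frac_part a orig (otgt x)) ` c)"

definition findex :: "('d \<Rightarrow> real ^ 'd) \<Rightarrow> real ^ 'd \<Rightarrow> 'd oedge set \<Rightarrow> int ^ 'd" where
  "findex a orig c = the_elem (oindex a orig ` c)"

definition bridges ::
  "(real ^ 'd) set \<Rightarrow> (real ^ 'd) set set \<Rightarrow> ('d \<Rightarrow> real ^ 'd) \<Rightarrow> real ^ 'd \<Rightarrow> 'd oedge set set" where
  "bridges V E a orig = {c \<in> fund_oedges V E a. findex a orig c \<noteq> 0}"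

text \<open>
  \<open>(V, E)\<close> is a loop graph if the following holds for some periods \<open>a\<close> and some origin \<open>orig\<close>;
  these then determine the loop fundamental graph.
\<close>

definition loop_fundamental_graph ::
  "(real ^ 'd) set \<Rightarrow> (real ^ 'd) set set \<Rightarrow> ('d \<Rightarrow> real ^ 'd) \<Rightarrow> real ^ 'd \<Rightarrow> bool" where
  "loop_fundamental_graph V E a orig \<longleftrightarrow>
     periodic_graph V E a \<and> (\<forall>c\<in>bridges V E a orig. fsrc a orig c = ftgt a orig c)"

text \<open>
  Points of the torus are given by representatives \<open>\<theta> :: real ^ 'd\<close>; everything below depends on
  \<open>\<theta>\<close> only through the numbers \<open>exp (\<i> \<langle>\<tau>, \<theta>\<rangle>)\<close> with \<open>\<tau>\<close> integral.
\<close>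

definition pairing :: "int ^ 'd \<Rightarrow> real ^ 'd \<Rightarrow> real" where
  "pairing m \<theta> = (\<Sum>s\<in>UNIV. of_int (m $ s) * \<theta> $ s)"

definition precise_quasimomentum ::
  "(real ^ 'd) set \<Rightarrow> (real ^ 'd) set set \<Rightarrow> ('d \<Rightarrow> real ^ 'd) \<Rightarrow> real ^ 'd \<Rightarrow> real ^ 'd \<Rightarrow> bool" where
  "precise_quasimomentum V E a orig \<theta> \<longleftrightarrow>
     (\<forall>c\<in>bridges V E a orig. cos (pairing (findex a orig c) \<theta>) = -1)"

section \<open>The Schroedinger operator and its spectrum\<close>

definition periodic_potential ::
  "(real ^ 'd) set \<Rightarrow> ('d \<Rightarrow> real ^ 'd) \<Rightarrow> (real ^ 'd \<Rightarrow> real) \<Rightarrow> bool" where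
  "periodic_potential V a Q \<longleftrightarrow> (\<forall>v\<in>V. \<forall>m. Q (v + lattice_vec a m) = Q v)"

text \<open>Functions on \<open>V\<close> are represented by their extensions by zero.\<close>

definition ell2 :: "'v set \<Rightarrow> ('v \<Rightarrow> complex) set" where
  "ell2 V = {f. (\<forall>v. v \<notin> V \<longrightarrow> f v = 0) \<and> (\<lambda>v. (cmod (f v))\<^sup>2) summable_on V}"

definition ell2_norm :: "'v set \<Rightarrow> ('v \<Rightarrow> complex) \<Rightarrow> real" where
  "ell2_norm V f = sqrt (\<Sum>\<^sub>\<infinity>v\<in>V. (cmod (f v))\<^sup>2)"

text \<open>
  The sum over the edges at \<open>v\<close> is written as a sum over the oriented edges starting at \<open>v\<close>, which
  provide the other end point; loops contribute zero.
\<close>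

definition laplacian ::
  "(real ^ 'd) set \<Rightarrow> (real ^ 'd) set set \<Rightarrow> (real ^ 'd \<Rightarrow> complex) \<Rightarrow> real ^ 'd \<Rightarrow> complex" where
  "laplacian V E f v = (\<Sum>x\<in>{x \<in> oedges V E. osrc x = v}. f v - f (otgt x))"

definition schroedinger ::
  "(real ^ 'd) set \<Rightarrow> (real ^ 'd) set set \<Rightarrow> (real ^ 'd \<Rightarrow> real) \<Rightarrow>
    (real ^ 'd \<Rightarrow> complex) \<Rightarrow> real ^ 'd \<Rightarrow> complex" where
  "schroedinger V E Q f v = (if v \<in> V then laplacian V E f v + of_real (Q v) * f v else 0)"

text \<open>The complement of the set of all \<open>z\<close> for which \<open>T - z\<close> has a bounded inverse on \<open>ell2 V\<close>.\<close>

definition ell2_spectrum :: "'v set \<Rightarrow> (('v \<Rightarrow> complex) \<Rightarrow> 'v \<Rightarrow> complex) \<Rightarrow> complex set" where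
  "ell2_spectrum V T = {z. \<not> (bij_betw (\<lambda>f v. T f v - z * f v) (ell2 V) (ell2 V) \<and>
     (\<exists>C. \<forall>f\<in>ell2 V. ell2_norm V f \<le> C * ell2_norm V (\<lambda>v. T f v - z * f v)))}"

text \<open>The operator is self-adjoint, so its spectrum is contained in the real line.\<close>

definition schroedinger_spectrum ::
  "(real ^ 'd) set \<Rightarrow> (real ^ 'd) set set \<Rightarrow> (real ^ 'd \<Rightarrow> real) \<Rightarrow> real set" where
  "schroedinger_spectrum V E Q = {x. complex_of_real x \<in> ell2_spectrum V (schroedinger V E Q)}"

section \<open>Floquet matrices and spectral bands\<close>

text \<open>The list \<open>vs\<close> enumerates the vertices \<open>v\<^sub>1, \<dots>, v\<^sub>\<nu>\<close> of the fundamental graph.\<close>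

definition floquet_matrix ::
  "(real ^ 'd) set \<Rightarrow> (real ^ 'd) set set \<Rightarrow> ('d \<Rightarrow> real ^ 'd) \<Rightarrow> real ^ 'd \<Rightarrow> (real ^ 'd \<Rightarrow> real) \<Rightarrow>
    (real ^ 'd) list \<Rightarrow> real ^ 'd \<Rightarrow> complex mat" where
  "floquet_matrix V E a orig Q vs \<theta> = mat (length vs) (length vs) (\<lambda>(j, k).
     (if j = k then of_nat (degree_at V E (vs ! j)) + of_real (Q (vs ! j)) else 0)
     - (\<Sum>c\<in>{c \<in> fund_oedges V E a. fsrc a orig c = vs ! j \<and> ftgt a orig c = vs ! k}.
          exp (\<i> * of_real (pairing (findex a orig c) \<theta>))))"

text \<open>
  The eigenvalues, counted with multiplicity, are the roots of the characteristic polynomial; they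
  are real since the Floquet matrix is Hermitian. The index \<open>n\<close> ranges over \<open>1, \<dots>, \<nu>\<close>.
\<close>

definition band_fun ::
  "(real ^ 'd) set \<Rightarrow> (real ^ 'd) set set \<Rightarrow> ('d \<Rightarrow> real ^ 'd) \<Rightarrow> real ^ 'd \<Rightarrow> (real ^ 'd \<Rightarrow> real) \<Rightarrow>
    (real ^ 'd) list \<Rightarrow> nat \<Rightarrow> real ^ 'd \<Rightarrow> real" where
  "band_fun V E a orig Q vs n \<theta> = sorted_list_of_multiset
     (image_mset Re (proots (char_poly (floquet_matrix V E a orig Q vs \<theta>)))) ! (n - 1)"

definition band ::
  "(real ^ 'd) set \<Rightarrow> (real ^ 'd) set set \<Rightarrow> ('d \<Rightarrow> real ^ 'd) \<Rightarrow> real ^ 'd \<Rightarrow> (real ^ 'd \<Rightarrow> real) \<Rightarrow>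
    (real ^ 'd) list \<Rightarrow> nat \<Rightarrow> real set" where
  "band V E a orig Q vs n = range (band_fun V E a orig Q vs n)"

end

theory Submission
  imports Defs "Jordan_Normal_Form.Schur_Decomposition"
begin

text \<open>
  The bridges being loops, they enter the Floquet matrix only through the diagonal, where they contribute
  sums of \<open>1 - cos \<langle>\<tau>, \<theta>\<rangle> \<in> [0, 2]\<close>. So \<open>H(0) \<le> H(\<theta>) \<le> H(\<theta>\<^sub>0)\<close>, and min-max locates the band ends; the
  trace of \<open>H(\<theta>\<^sub>0) - H(0)\<close> gives the total length. If all bridges sit at one vertex, \<open>H(\<theta>\<^sub>0) - H(0)\<close> has
  rank at most one, hence the bands interlace and overlap in at most a point. That the spectrum is the union of the
  bands is needed in this case only and does not require the Floquet transform: Bloch waves with a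
  slowly decaying envelope are approximate eigenfunctions, and off the bands the resolvent is the
  resolvent of a single matrix corrected by a convergent Neumann series of lattice shifts.
\<close>

no_notation Matrix.vec_index (infixl "$" 100)

section \<open>Hermitian matrices\<close>

text \<open>The eigenvalues are given as sorted real parts of the roots of a characteristic
  polynomial, a form in which neither monotonicity nor continuity is visible. Hence the route
  through an orthonormal eigenbasis to a single min-max inequality between quadratic forms; it also
  covers continuity in \<theta>, which makes the bands intervals. Only cosines occur because for a
  loop the phase multiplies a squared modulus, and the form keeps the real part. At a precise
  quasimomentum each oriented bridge contributes 1 - (-1) = 2, whence 2 \<beta>. With all bridges at
  one vertex, H(\<theta>) has the quadratic form of H(0) plus r times the projection to one
  coordinate, where r, the sum of the 1 - cos, lies in [0, 2 \<beta>]. The midpoint r = \<beta> is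
  H(0) with the bridge terms deleted and the degrees kept. Around it the bridges act as shifts of
  total norm at most \<beta>, which is why this is the matrix whose resolvent gets
  corrected.\<close>

definition inner_n :: "nat \<Rightarrow> (nat \<Rightarrow> complex) \<Rightarrow> (nat \<Rightarrow> complex) \<Rightarrow> complex" where
  "inner_n n x y = (\<Sum>i<n. cnj (x i) * y i)"

definition apply_mat :: "nat \<Rightarrow> (nat \<Rightarrow> nat \<Rightarrow> complex) \<Rightarrow> (nat \<Rightarrow> complex) \<Rightarrow> nat \<Rightarrow> complex" where
  "apply_mat n A x i = (\<Sum>j<n. A i j * x j)"

text \<open>Taking the real part makes the form real-valued for every \<open>A\<close>, so that no
  hermiticity has to be carried along.\<close>

definition quad_form :: "nat \<Rightarrow> (nat \<Rightarrow> nat \<Rightarrow> complex) \<Rightarrow> (nat \<Rightarrow> complex) \<Rightarrow> real" where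
  "quad_form n A x = Re (inner_n n x (apply_mat n A x))"

definition hermitian_n :: "nat \<Rightarrow> (nat \<Rightarrow> nat \<Rightarrow> complex) \<Rightarrow> bool" where
  "hermitian_n n A \<longleftrightarrow> (\<forall>i<n. \<forall>j<n. A j i = cnj (A i j))"

lemma inner_n_cong: "(\<And>i. i < n \<Longrightarrow> x i = x' i) \<Longrightarrow> (\<And>i. i < n \<Longrightarrow> y i = y' i) \<Longrightarrow>
    inner_n n x y = inner_n n x' y'"
  unfolding inner_n_def by (intro sum.cong) auto

lemma inner_n_commute: "inner_n n y x = cnj (inner_n n x y)"
  unfolding inner_n_def by (simp add: mult.commute)

lemma inner_n_sum_right: "inner_n n x (\<lambda>i. \<Sum>l\<in>S. c l * y l i) = (\<Sum>l\<in>S. c l * inner_n n x (y l))"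
  unfolding inner_n_def sum_distrib_left by (subst sum.swap) (simp add: ac_simps)

lemma inner_n_sum_left: "inner_n n (\<lambda>i. \<Sum>l\<in>S. c l * y l i) x = (\<Sum>l\<in>S. cnj (c l)
    * inner_n n (y l) x)"
  unfolding inner_n_def sum_distrib_left cnj_sum sum_distrib_right
  by (subst sum.swap) (simp add: ac_simps)

lemma inner_n_diff_right: "inner_n n x (\<lambda>i. y i - z i) = inner_n n x y - inner_n n x z"
  unfolding inner_n_def by (simp add: algebra_simps sum_subtractf)

lemma inner_n_scale_right: "inner_n n x (\<lambda>i. c * y i) = c * inner_n n x y"
  unfolding inner_n_def sum_distrib_left by (simp add: ac_simps)

lemma inner_n_scale_left: "inner_n n (\<lambda>i. c * x i) y = cnj c * inner_n n x y"
  unfolding inner_n_def sum_distrib_left by (simp add: ac_simps)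

lemma inner_n_self: "inner_n n x x = of_real (\<Sum>i<n. (cmod (x i))\<^sup>2)"
  unfolding inner_n_def of_real_sum by (intro sum.cong refl) (simp add: complex_norm_square
    mult.commute del: of_real_power)

lemma inner_n_self_eq_0: "inner_n n x x = 0 \<longleftrightarrow> (\<forall>i<n. x i = 0)"
  unfolding inner_n_self of_real_eq_0_iff by (subst sum_nonneg_eq_0_iff) auto

lemma hermitian_nD: "hermitian_n n A \<Longrightarrow> i < n \<Longrightarrow> j < n \<Longrightarrow> cnj (A j i) = A i j"
  unfolding hermitian_n_def by (metis complex_cnj_cnj)

lemma hermitian_inner:
  assumes "hermitian_n n A"
  shows "inner_n n x (apply_mat n A y) = inner_n n (apply_mat n A x) y"
proof -
  have "inner_n n x (apply_mat n A y) = (\<Sum>i<n. \<Sum>j<n. cnj (x i) * (A i j * y j))"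
    by (simp add: inner_n_def apply_mat_def sum_distrib_left)
  also have "\<dots> = (\<Sum>j<n. \<Sum>i<n. cnj (x i) * (A i j * y j))" by (rule sum.swap)
  also have "\<dots> = (\<Sum>j<n. \<Sum>i<n. cnj (A j i * x i) * y j)"
    by (intro sum.cong refl) (simp add: hermitian_nD[OF assms] ac_simps)
  finally show ?thesis by (simp add: inner_n_def apply_mat_def sum_distrib_right)
qed

text \<open>A zero row pads the \<open>p\<close> equations to a square matrix, whose determinant
  vanishes by Laplace expansion along that row. This dimension count serves Gram-Schmidt as well as
  min-max.\<close>

lemma underdetermined_system:
  fixes a :: "nat \<Rightarrow> nat \<Rightarrow> complex"
  shows "\<exists>c. (\<exists>l\<le>p. c l \<noteq> 0) \<and> (\<forall>k<p. (\<Sum>l\<le>p. a k l * c l) = 0)"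
proof -
  define M where "M = mat (Suc p) (Suc p) (\<lambda>(k, l). if k < p then a k l else 0)"
  have M: "M \<in> carrier_mat (Suc p) (Suc p)" by (simp add: M_def)
  have "det M = (\<Sum>j<Suc p. M $$ (p, j) * cofactor M p j)"
    by (rule laplace_expansion_row[OF M]) simp
  also have "\<dots> = 0" by (intro sum.neutral) (simp add: M_def)
  finally obtain v where v: "v \<in> carrier_vec (Suc p)" "v \<noteq> 0\<^sub>v (Suc p)" "M *\<^sub>v v = 0\<^sub>v (Suc p)"
    using det_0_iff_vec_prod_zero[OF M] by auto
  have "\<exists>l\<le>p. vec_index v l \<noteq> 0"
  proof (rule ccontr)
    assume "\<not> ?thesis"
    then have "v = 0\<^sub>v (Suc p)" using v(1) by (intro eq_vecI) auto
    with v(2) show False ..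
  qed
  moreover have "(\<Sum>l\<le>p. a k l * vec_index v l) = 0" if "k < p" for k
  proof -
    have "vec_index (M *\<^sub>v v) k = (\<Sum>l<Suc p. a k l * vec_index v l)"
      using that v(1) by (simp add: M_def scalar_prod_def atLeast0LessThan)
    then show ?thesis using that by (simp add: v(3) lessThan_Suc_atMost)
  qed
  ultimately show ?thesis by (intro exI[of _ "\<lambda>l. vec_index v l"] conjI allI impI)
qed

text \<open>\<open>e\<close> is complex because the roots of the characteristic polynomial are not
  yet known to be real. Completeness is left out because it follows from orthonormality of
  \<open>n\<close> vectors.\<close>

definition eigenbasis :: "nat \<Rightarrow> (nat \<Rightarrow> nat \<Rightarrow> complex) \<Rightarrow> (nat \<Rightarrow> complex) \<Rightarrow> (nat \<Rightarrow> nat \<Rightarrow> complex) \<Rightarrow> bool" where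
  "eigenbasis n A e u \<longleftrightarrow>
     (\<forall>l<n. \<forall>m<n. inner_n n (u l) (u m) = (if l = m then 1 else 0)) \<and>
     (\<forall>l<n. \<forall>i<n. apply_mat n A (u l) i = e l * u l i)"

text \<open>
  Gram-Schmidt applied to a triangularising basis \<open>p\<close>. The residual \<open>A u\<^sub>l - e\<^sub>l u\<^sub>l\<close> lies in the
  span of \<open>p\<^sub>0, \<dots>, p\<^sub>l\<^sub>-\<^sub>1\<close>, which is \<open>A\<close>-invariant and orthogonal to \<open>u\<^sub>l\<close>; so it is orthogonal to
  itself when \<open>A\<close> is Hermitian.
\<close>

lemma hermitian_eigenbasis:
  assumes herm: "hermitian_n n A"
    and cp: "char_poly (mat n n (\<lambda>(i, j). A i j)) = (\<Prod>e\<leftarrow>es. [:- e, 1:])"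
  shows "\<exists>u. eigenbasis n A ((!) es) u"
proof -
  let ?A = "mat n n (\<lambda>(i, j). A i j)"
  have A: "?A \<in> carrier_mat n n" by simp
  obtain B P P' where "schur_decomposition ?A es = (B, P, P')"
    by (cases "schur_decomposition ?A es")
  from schur_decomposition[OF A cp this]
  have sim: "similar_mat_wit ?A B P P'" and ut: "upper_triangular B" and diag: "diag_mat B = es"
    by auto
  from similar_mat_witD2[OF A sim] have
    P: "P \<in> carrier_mat n n" "P' \<in> carrier_mat n n" "B \<in> carrier_mat n n" "P' * P = 1\<^sub>m n"
    and AP: "?A = P * B * P'" by auto
  have AP': "?A * P = P * B"
  proof -
    have "?A * P = P * B * (P' * P)" unfolding AP using P
        by (simp add: assoc_mult_mat[of _ n n _ n _ n])
    then show ?thesis using P by simp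
  qed
  define p where "p l i = P $$ (i, l)" for l i
  have Ap: "apply_mat n A (p l) i = (\<Sum>q<l. B $$ (q, l) * p q i) + es ! l * p l i"
    if "l < n" "i < n" for l i
  proof -
    have "apply_mat n A (p l) i = (?A * P) $$ (i, l)"
      using that P by (simp add: apply_mat_def p_def scalar_prod_def atLeast0LessThan)
    also have "\<dots> = (\<Sum>q<n. P $$ (i, q) * B $$ (q, l))"
      using that P unfolding AP' by (simp add: scalar_prod_def atLeast0LessThan)
    also have "\<dots> = (\<Sum>q<Suc l. P $$ (i, q) * B $$ (q, l))"
      using that P ut by (intro sum.mono_neutral_right) (auto simp: upper_triangular_def)
    also have "es ! l = B $$ (l, l)" using that P unfolding diag[symmetric] diag_mat_def by simp
    ultimately show ?thesis by (simp add: p_def mult.commute)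
  qed
  have indep: "\<forall>l<n. c l = 0" if c: "\<forall>i<n. (\<Sum>l<n. c l * p l i) = 0" for c
  proof -
    define v where "v = Matrix.vec n c"
    have v: "v \<in> carrier_vec n" by (simp add: v_def)
    have "P *\<^sub>v v = 0\<^sub>v n"
      using P c by (intro eq_vecI) (auto simp: v_def scalar_prod_def p_def atLeast0LessThan
        mult.commute)
    then have "(P' * P) *\<^sub>v v = P' *\<^sub>v 0\<^sub>v n"
      using assoc_mult_mat_vec[OF P(2,1) v] by simp
    then have "1\<^sub>m n *\<^sub>v v = P' *\<^sub>v 0\<^sub>v n" using P(4) by metis
    moreover have "P' *\<^sub>v 0\<^sub>v n = 0\<^sub>v n" using P by (intro eq_vecI) (auto simp: scalar_prod_def)
    ultimately have "v = 0\<^sub>v n" using v by simp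
    then show ?thesis by (metis index_vec index_zero_vec(1) v_def)
  qed
  \<comment> \<open>Gram-Schmidt without division: \<open>l\<close> orthogonality conditions on
    \<open>l + 1\<close> coefficients. That the resulting vector is nonzero comes later, from the
    independence of the columns of \<open>P\<close>.\<close>
  have "\<exists>c. (\<exists>i\<le>l. c i \<noteq> 0) \<and> (\<forall>k<l. inner_n n (p k) (\<lambda>i. \<Sum>q\<le>l. c q * p q i) = 0)" for l
    using underdetermined_system[of l "\<lambda>k q. inner_n n (p k) (p q)"]
    by (auto simp: inner_n_sum_right mult.commute)
  then have "\<forall>l. \<exists>c. (\<exists>i\<le>l. c i \<noteq> 0) \<and> (\<forall>k<l. inner_n n (p k) (\<lambda>i. \<Sum>q\<le>l. c q * p q i) = 0)"
    by blast
  from choice[OF this] obtain c where c: "\<And>l. \<exists>i\<le>l. c l i \<noteq> 0"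
    and orth: "\<And>l k. k < l \<Longrightarrow> inner_n n (p k) (\<lambda>i. \<Sum>q\<le>l. c l q * p q i) = 0"
    by blast
  define y where "y l i = (\<Sum>q\<le>l. c l q * p q i)" for l i
  have y_orth: "inner_n n (p k) (y l) = 0" if "k < l" for k l
    using orth[OF that] unfolding y_def .
  have y_span: "inner_n n (\<lambda>i. \<Sum>q<l. d q * p q i) (y l) = 0" for d l
    unfolding inner_n_sum_left using y_orth by simp
  have yy0: "inner_n n (y k) (y l) = 0" if "k < l" for k l
  proof -
    have "inner_n n (y k) (y l) = (\<Sum>q\<le>k. cnj (c k q) * inner_n n (p q) (y l))"
      unfolding y_def[of k] by (rule inner_n_sum_left)
    also have "\<dots> = 0" using that y_orth by simp
    finally show ?thesis .
  qed
  then have yy: "inner_n n (y k) (y l) = 0" if "k \<noteq> l" for k l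
    using that by (metis complex_cnj_zero inner_n_commute linorder_neqE_nat)
  have y_nz: "inner_n n (y l) (y l) \<noteq> 0" if "l < n" for l
  proof
    assume "inner_n n (y l) (y l) = 0"
    then have "\<forall>i<n. y l i = 0" by (simp add: inner_n_self_eq_0)
    moreover have "y l i = (\<Sum>q<n. (if q \<le> l then c l q else 0) * p q i)" for i
      unfolding y_def using that by (intro sum.mono_neutral_cong_left) auto
    ultimately have *: "\<forall>i<n. (\<Sum>q<n. (if q \<le> l then c l q else 0) * p q i) = 0" by metis
    have "\<forall>q<n. (if q \<le> l then c l q else 0) = 0" by (rule indep[OF *])
    moreover obtain i where "i \<le> l" "c l i \<noteq> 0" using c by blast
    ultimately show False using that by (metis le_less_trans)
  qed
  have Ay: "apply_mat n A (y l) i = es ! l * y l i" if "l < n" "i < n" for l i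
  proof -
    have expand: "apply_mat n A (\<lambda>i. \<Sum>q\<in>S. d q * p q i) i =
      (\<Sum>q\<in>S. d q * ((\<Sum>r<q. B $$ (r, q) * p r i) + es ! q * p q i))" if "i <
          n" "S \<subseteq> {..<n}" for d S i
    proof -
      have "apply_mat n A (\<lambda>i. \<Sum>q\<in>S. d q * p q i) i = (\<Sum>q\<in>S. d q * apply_mat n A (p q) i)"
        unfolding apply_mat_def sum_distrib_left by (subst sum.swap) (simp add: ac_simps)
      also have "\<dots> = (\<Sum>q\<in>S. d q * ((\<Sum>r<q. B $$ (r, q) * p r i) + es ! q * p q i))"
        using that by (intro sum.cong refl) (subst Ap, auto)
      finally show ?thesis .
    qed
    \<comment> \<open>The strictly triangular part lowers the index, so it sends combinations of the
      columns up to \<open>p l\<close> to combinations of the columns before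
      \<open>p l\<close>.\<close>
    have lower: "\<exists>d'. \<forall>i<n. (\<Sum>q\<in>S. d q * (\<Sum>r<q. B $$ (r, q) * p r i)) = (\<Sum>r<l. d' r * p r i)"
      if "finite S" "S \<subseteq> {..l}" for S d
    proof (intro exI allI impI)
      fix i
      have "(\<Sum>q\<in>S. d q * (\<Sum>r<q. B $$ (r, q) * p r i)) = (\<Sum>q\<in>S. \<Sum>r<l. if r < q then d q
          * B $$ (r, q) * p r i else 0)"
        unfolding sum_distrib_left using that
          by (intro sum.cong refl sum.mono_neutral_cong_left) (auto simp: ac_simps)
      also have "\<dots> = (\<Sum>r<l. (\<Sum>q\<in>S. if r < q then d q * B $$ (r, q) else 0) * p r i)"
        unfolding sum_distrib_right by (subst sum.swap) (intro sum.cong refl, auto)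
      finally show "(\<Sum>q\<in>S. d q * (\<Sum>r<q. B $$ (r, q) * p r i)) = (\<Sum>r<l. (\<Sum>q\<in>S. if r < q then d q
          * B $$ (r, q) else 0) * p r i)" .
    qed
    define z where "z i = apply_mat n A (y l) i - es ! l * y l i" for i
    have "\<exists>d. \<forall>i<n. z i = (\<Sum>r<l. d r * p r i)"
    proof -
      obtain d where d: "\<forall>i<n. (\<Sum>q\<le>l. c l q * (\<Sum>r<q. B $$ (r, q) * p r i)) = (\<Sum>r<l. d r * p r i)"
        using lower[of "{..l}" "c l"] by auto
      \<comment> \<open>The coefficient of \<open>p l\<close> cancels, since \<open>A\<close> acts
        on \<open>p l\<close> as \<open>es ! l\<close> modulo earlier columns.\<close>
      have "z i = (\<Sum>r<l. (d r + c l r * (es ! r - es ! l)) * p r i)" if "i < n" for i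
      proof -
        have "apply_mat n A (y l) i = (\<Sum>q\<le>l. c l q * (\<Sum>r<q. B $$ (r, q) * p r i)) + (\<Sum>q\<le>l. c l q
            * es ! q * p q i)"
          unfolding y_def using that \<open>l < n\<close>
            by (subst expand) (auto simp: sum.distrib algebra_simps)
        also have "\<dots> = (\<Sum>r<l. d r * p r i) + ((\<Sum>q<l. c l q * es ! q * p q i) + c l l * es ! l
            * p l i)"
          using d that by (simp add: lessThan_Suc_atMost[symmetric])
        finally show ?thesis
          by (simp add: z_def y_def lessThan_Suc_atMost[symmetric] sum.distrib sum_subtractf
            algebra_simps sum_distrib_left)
      qed
      then show ?thesis by (intro exI[of _ "\<lambda>r. d r + c l r * (es ! r - es ! l)"]) blast
    qed
    then obtain d where d: "\<And>i. i < n \<Longrightarrow> z i = (\<Sum>r<l. d r * p r i)" by blast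
    have zy: "inner_n n z (y l) = 0"
      using y_span[of d l] d inner_n_cong[of n z "\<lambda>i. \<Sum>r<l. d r * p r i" "y l" "y l"] by simp
    have Az: "inner_n n (apply_mat n A z) (y l) = 0"
    proof -
      obtain d' where d': "\<forall>i<n. (\<Sum>q<l. d q * (\<Sum>r<q. B $$ (r, q) * p r i)) = (\<Sum>r<l. d' r * p r i)"
        using lower[OF finite_lessThan, of l d] by fastforce
      have "apply_mat n A z i = (\<Sum>r<l. (d' r + d r * es ! r) * p r i)" if "i < n" for i
      proof -
        have "apply_mat n A z i = apply_mat n A (\<lambda>i. \<Sum>r<l. d r * p r i) i"
          using d by (simp add: apply_mat_def)
        also have "\<dots> = (\<Sum>r<l. (d' r + d r * es ! r) * p r i)"
          using that \<open>l < n\<close> d' by (subst expand) (auto simp: algebra_simps sum.distrib)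
        finally show ?thesis .
      qed
      then show ?thesis
        using y_span[of "\<lambda>r. d' r + d r * es ! r" l] inner_n_cong[of n "apply_mat n A z"
            "\<lambda>i. \<Sum>r<l. (d' r + d r * es ! r) * p r i" "y l" "y l"] by simp
    qed
    have "inner_n n z z = inner_n n z (apply_mat n A (y l)) - es ! l * inner_n n z (y l)"
      unfolding z_def[abs_def] inner_n_diff_right inner_n_scale_right ..
    also have "\<dots> = 0" using hermitian_inner[OF herm] zy Az by simp
    finally show ?thesis using that unfolding inner_n_self_eq_0 z_def by simp
  qed
  define nm where "nm l = sqrt (\<Sum>i<n. (cmod (y l i))\<^sup>2)" for l
  have nm: "inner_n n (y l) (y l) = of_real (nm l) * of_real (nm l)" for l
    unfolding inner_n_self nm_def of_real_mult[symmetric] by (simp add: sum_nonneg)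
  define u where "u l i = of_real (1 / nm l) * y l i" for l i
  have "inner_n n (u l) (u m) = (if l = m then 1 else 0)" if "l < n" "m < n" for l m
  proof -
    have "inner_n n (u l) (u m) = of_real (1 / nm l) * of_real (1 / nm m) * inner_n n (y l) (y m)"
      unfolding u_def[abs_def] inner_n_scale_left inner_n_scale_right by simp
    then show ?thesis
      using yy[of l m] y_nz[of l] that nm[of l] by auto
  qed
  moreover have "apply_mat n A (u l) i = es ! l * u l i" if "l < n" "i < n" for l i
  proof -
    have "apply_mat n A (u l) i = of_real (1 / nm l) * apply_mat n A (y l) i"
      unfolding apply_mat_def u_def sum_distrib_left by (simp add: ac_simps)
    then show ?thesis using Ay[OF that] by (simp add: u_def)
  qed
  ultimately show ?thesis unfolding eigenbasis_def by blast
qed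

text \<open>Orthonormality says that the matrix with columns \<open>u l\<close> has its adjoint as a
  left inverse; for square matrices this is also a right inverse, which is the resolution of the
  identity.\<close>

lemma eigenbasis_complete:
  assumes "eigenbasis n A e u" "i < n" "j < n"
  shows "(\<Sum>l<n. u l i * cnj (u l j)) = (if i = j then 1 else 0)"
proof -
  define U where "U = mat n n (\<lambda>(i, l). u l i)"
  define U' where "U' = mat n n (\<lambda>(l, i). cnj (u l i))"
  have carrier: "U \<in> carrier_mat n n" "U' \<in> carrier_mat n n" by (auto simp: U_def U'_def)
  have "U' * U = 1\<^sub>m n"
    using assms(1) by (intro eq_matI)
      (auto simp: U_def U'_def scalar_prod_def eigenbasis_def inner_n_def atLeast0LessThan)
  then have "U * U' = 1\<^sub>m n" using mat_mult_left_right_inverse[of U' n U] carrier by simp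
  then have "(U * U') $$ (i, j) = 1\<^sub>m n $$ (i, j)" by simp
  then show ?thesis using assms(2,3)
    by (simp add: U_def U'_def scalar_prod_def atLeast0LessThan)
qed

lemma eigenbasis_expand:
  assumes "eigenbasis n A e u" "i < n"
  shows "x i = (\<Sum>l<n. inner_n n (u l) x * u l i)"
proof -
  have "(\<Sum>l<n. inner_n n (u l) x * u l i) = (\<Sum>j<n. \<Sum>l<n. u l i * cnj (u l j) * x j)"
    unfolding inner_n_def sum_distrib_right by (subst sum.swap) (simp add: ac_simps)
  also have "\<dots> = (\<Sum>j<n. (if i = j then 1 else 0) * x j)"
    unfolding sum_distrib_right[symmetric] using eigenbasis_complete[OF assms] by simp
  also have "\<dots> = x i" using assms(2) by (simp add: if_distrib[of "\<lambda>a. a * _"] cong: if_cong)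
  finally show ?thesis by simp
qed

lemma eigenbasis_apply:
  assumes "eigenbasis n A e u" "i < n"
  shows "apply_mat n A x i = (\<Sum>l<n. e l * inner_n n (u l) x * u l i)"
proof -
  have "apply_mat n A x i = (\<Sum>j<n. A i j * (\<Sum>l<n. inner_n n (u l) x * u l j))"
    unfolding apply_mat_def using eigenbasis_expand[OF assms(1), of _ x] by simp
  also have "\<dots> = (\<Sum>l<n. inner_n n (u l) x * apply_mat n A (u l) i)"
    unfolding apply_mat_def sum_distrib_left by (subst sum.swap) (simp add: ac_simps)
  also have "\<dots> = (\<Sum>l<n. e l * inner_n n (u l) x * u l i)"
    using assms unfolding eigenbasis_def by (intro sum.cong refl) simp
  finally show ?thesis .
qed

lemma eigenbasis_inner:
  assumes "eigenbasis n A e u"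
  shows "inner_n n x y = (\<Sum>l<n. cnj (inner_n n (u l) x) * inner_n n (u l) y)"
proof -
  have "inner_n n x y = inner_n n x (\<lambda>i. \<Sum>l<n. inner_n n (u l) y * u l i)"
    using eigenbasis_expand[OF assms, of _ y] by (intro inner_n_cong) auto
  also have "\<dots> = (\<Sum>l<n. inner_n n (u l) y * inner_n n x (u l))" by (rule inner_n_sum_right)
  also have "\<dots> = (\<Sum>l<n. cnj (inner_n n (u l) x) * inner_n n (u l) y)"
    by (intro sum.cong refl) (subst inner_n_commute[of n x], simp add: mult.commute)
  finally show ?thesis .
qed

lemma eigenbasis_norm:
  assumes "eigenbasis n A e u"
  shows "(\<Sum>i<n. (cmod (x i))\<^sup>2) = (\<Sum>l<n. (cmod (inner_n n (u l) x))\<^sup>2)"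
proof -
  have "complex_of_real (\<Sum>i<n. (cmod (x i))\<^sup>2) = inner_n n x x" by (rule inner_n_self[symmetric])
  also have "\<dots> = inner_n n (\<lambda>l. inner_n n (u l) x) (\<lambda>l. inner_n n (u l) x)"
    unfolding eigenbasis_inner[OF assms, of x x]
      by (simp add: inner_n_def[of n "\<lambda>l. inner_n n (u l) x"])
  also have "\<dots> = of_real (\<Sum>l<n. (cmod (inner_n n (u l) x))\<^sup>2)" by (rule inner_n_self)
  finally show ?thesis unfolding of_real_eq_iff .
qed

lemma eigenbasis_quad_form:
  assumes "eigenbasis n A (\<lambda>l. of_real (r l)) u"
  shows "quad_form n A x = (\<Sum>l<n. r l * (cmod (inner_n n (u l) x))\<^sup>2)"
proof -
  have "inner_n n x (apply_mat n A x) = inner_n n x (\<lambda>i. \<Sum>l<n. (of_real (r l) * inner_n n (u l) x)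
      * u l i)"
    using eigenbasis_apply[OF assms, of _ x] by (intro inner_n_cong) auto
  also have "\<dots> = (\<Sum>l<n. (of_real (r l) * inner_n n (u l) x) * inner_n n x (u l))"
    by (rule inner_n_sum_right)
  also have "\<dots> = (\<Sum>l<n. of_real (r l * (cmod (inner_n n (u l) x))\<^sup>2))"
    by (intro sum.cong refl, subst inner_n_commute[of n x])
      (simp add: complex_norm_square mult.assoc del: of_real_power)
  finally show ?thesis by (simp add: quad_form_def)
qed

text \<open>The eigenvalue equals \<open>inner_n n (u l) (apply_mat n A (u l))\<close>, and moving
  \<open>A\<close> to the other side conjugates it.\<close>

lemma eigenbasis_real:
  assumes "hermitian_n n A" "eigenbasis n A e u" "l < n"
  shows "e l = of_real (Re (e l))"
proof -
  have one: "inner_n n (u l) (u l) = 1" using assms by (auto simp: eigenbasis_def)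
  have "inner_n n (u l) (apply_mat n A (u l)) = e l * inner_n n (u l) (u l)"
    unfolding inner_n_scale_right[symmetric]
    using assms by (intro inner_n_cong) (auto simp: eigenbasis_def)
  then have "e l = cnj (e l)"
    using hermitian_inner[OF assms(1), of "u l" "u l"] one
      inner_n_commute[of n "u l" "apply_mat n A (u l)"] by simp
  then show ?thesis by (metis Reals_cnj_iff complex_is_Real_iff of_real_Re)
qed

section \<open>Ordered eigenvalues: min-max, trace and resolvent\<close>

definition eigs :: "nat \<Rightarrow> (nat \<Rightarrow> nat \<Rightarrow> complex) \<Rightarrow> real list" where
  "eigs n A = sorted_list_of_multiset (image_mset Re (proots (char_poly (mat n n (\<lambda>(i, j). A i j)))))"

lemma proots_prod_list_linear: "proots (\<Prod>e\<leftarrow>es. [:- e, 1:]) = mset es" for es :: "'a::idom list"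
proof (induction es)
  case (Cons e es)
  have "(\<Prod>e\<leftarrow>es. [:- e, 1:]) \<noteq> (0 :: 'a poly)" by (auto simp: prod_list_zero_iff)
  then show ?case using Cons by (simp add: proots_mult del: mult_pCons_left)
qed simp

text \<open>The factorisation lists the roots in an arbitrary order. It is used once to see that
  they are real, so that \<open>Re\<close> loses nothing; then the same polynomial is factored along
  the sorted list, which yields an eigenbasis in that order.\<close>

lemma eigs_spectral:
  assumes "hermitian_n n A"
  shows "sorted (eigs n A)" "length (eigs n A) = n"
    "\<exists>u. eigenbasis n A (\<lambda>l. of_real (eigs n A ! l)) u"
proof -
  let ?p = "char_poly (mat n n (\<lambda>(i, j). A i j))"
  obtain es where es: "?p = (\<Prod>e\<leftarrow>es. [:- e, 1:])" "length es = n"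
    using char_poly_factorized[of "mat n n (\<lambda>(i, j). A i j)" n] by auto
  obtain u where "eigenbasis n A ((!) es) u" using hermitian_eigenbasis[OF assms es(1)] ..
  from eigenbasis_real[OF assms this] have real: "map (\<lambda>e. of_real (Re e)) es = es"
    using es(2) by (intro nth_equalityI) auto
  have mset: "mset (eigs n A) = mset (map Re es)"
    unfolding eigs_def es(1) proots_prod_list_linear by simp
  show "sorted (eigs n A)" by (simp add: eigs_def)
  show len: "length (eigs n A) = n" using mset_eq_length[OF mset] es(2) by simp
  have "mset (map complex_of_real (eigs n A)) = image_mset of_real (mset (map Re es))"
    by (simp only: mset_map mset)
  also have "\<dots> = mset (map (\<lambda>e. of_real (Re e)) es)" by (simp add: multiset.map_comp o_def)
  finally have "mset (map complex_of_real (eigs n A)) = mset es" unfolding real .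
  then have "mset (map (\<lambda>e. [:- e, 1:]) (map complex_of_real (eigs n A)))
      = mset (map (\<lambda>e. [:- e, 1:]) es)"
    by (simp only: mset_map)
  then have "?p = (\<Prod>e\<leftarrow>map complex_of_real (eigs n A). [:- e, 1:])"
    unfolding es(1) by (metis prod_mset_prod_list)
  from hermitian_eigenbasis[OF assms this] obtain u
    where "eigenbasis n A ((!) (map complex_of_real (eigs n A))) u" ..
  then have "eigenbasis n A (\<lambda>l. of_real (eigs n A ! l)) u" using len by (simp add: eigenbasis_def)
  then show "\<exists>u. eigenbasis n A (\<lambda>l. of_real (eigs n A ! l)) u" by blast
qed

text \<open>
  Courant-Fischer: among the combinations of the first \<open>i + m + 1\<close> eigenvectors of \<open>A\<close> there is one
  that is orthogonal to the first \<open>i\<close> eigenvectors of \<open>B\<close> and annihilated by all \<open>w k\<close>.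
\<close>

lemma eigs_le:
  assumes A: "hermitian_n n A" and B: "hermitian_n n B" and im: "i + m < n"
    and le: "\<And>x. (\<And>k. k < m \<Longrightarrow> inner_n n (w k) x = 0) \<Longrightarrow>
      quad_form n B x \<le> quad_form n A x + \<epsilon> * (\<Sum>i<n. (cmod (x i))\<^sup>2)"
  shows "eigs n B ! i \<le> eigs n A ! (i + m) + \<epsilon>"
proof -
  obtain u where u: "eigenbasis n A (\<lambda>l. of_real (eigs n A ! l)) u" using eigs_spectral[OF A]
      by blast
  obtain v where v: "eigenbasis n B (\<lambda>l. of_real (eigs n B ! l)) v" using eigs_spectral[OF B]
      by blast
  define b where "b k = (if k < i then v k else w (k - i))" for k
  from underdetermined_system obtain c where
    "(\<exists>l\<le>i + m. c l \<noteq> 0) \<and> (\<forall>k<i + m. (\<Sum>l\<le>i + m. inner_n n (b k) (u l) * c l) = 0)" ..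
  then have c: "\<exists>l\<le>i + m. c l \<noteq> 0"
    and z: "\<And>k. k < i + m \<Longrightarrow> (\<Sum>l\<le>i + m. inner_n n (b k) (u l) * c l) = 0" by simp_all
  define x where "x q = (\<Sum>l\<le>i + m. c l * u l q)" for q
  have ux: "inner_n n (u l) x = (if l \<le> i + m then c l else 0)" if "l < n" for l
  proof -
    have "inner_n n (u l) x = (\<Sum>k\<le>i + m. c k * inner_n n (u l) (u k))"
      unfolding x_def by (rule inner_n_sum_right)
    also have "\<dots> = (\<Sum>k\<le>i + m. if l = k then c k else 0)"
      using u that im by (intro sum.cong refl) (auto simp: eigenbasis_def)
    finally show ?thesis by simp
  qed
  have vx: "inner_n n (v l) x = 0" if "l < i" for l
    using z[of l] that unfolding x_def inner_n_sum_right by (simp add: b_def mult.commute)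
  have wx: "inner_n n (w k) x = 0" if "k < m" for k
    using z[of "i + k"] that unfolding x_def inner_n_sum_right by (simp add: b_def mult.commute)
  define N where "N = (\<Sum>i<n. (cmod (x i))\<^sup>2)"
  have N1: "N = (\<Sum>l<n. (cmod (inner_n n (u l) x))\<^sup>2)" unfolding N_def
      by (rule eigenbasis_norm[OF u])
  have N2: "N = (\<Sum>l<n. (cmod (inner_n n (v l) x))\<^sup>2)" unfolding N_def
      by (rule eigenbasis_norm[OF v])
  have "N > 0"
  proof -
    obtain l where l: "l \<le> i + m" "c l \<noteq> 0" using c by blast
    then have "(cmod (inner_n n (u l) x))\<^sup>2 > 0" using ux[of l] im by simp
    moreover have "(cmod (inner_n n (u l) x))\<^sup>2 \<le> N"
      unfolding N1 using l im by (intro member_le_sum) auto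
    ultimately show ?thesis by (rule less_le_trans)
  qed
  \<comment> \<open>The squeeze: only eigenvalues of \<open>A\<close> up to index
    \<open>i + m\<close> act on \<open>x\<close>, and only those of \<open>B\<close> from index
    \<open>i\<close> on.\<close>
  have "quad_form n A x \<le> (\<Sum>l<n. eigs n A ! (i + m) * (cmod (inner_n n (u l) x))\<^sup>2)"
    unfolding eigenbasis_quad_form[OF u]
  proof (intro sum_mono)
    fix l assume "l \<in> {..<n}"
    then show "eigs n A ! l * (cmod (inner_n n (u l) x))\<^sup>2 \<le> eigs n A ! (i + m)
        * (cmod (inner_n n (u l) x))\<^sup>2"
      using ux[of l] im eigs_spectral[OF A]
      by (cases "l \<le> i + m") (auto intro!: mult_right_mono sorted_nth_mono)
  qed
  moreover have "(\<Sum>l<n. eigs n B ! i * (cmod (inner_n n (v l) x))\<^sup>2) \<le> quad_form n B x"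
    unfolding eigenbasis_quad_form[OF v]
  proof (intro sum_mono)
    fix l assume "l \<in> {..<n}"
    then show "eigs n B ! i * (cmod (inner_n n (v l) x))\<^sup>2 \<le> eigs n B ! l
        * (cmod (inner_n n (v l) x))\<^sup>2"
      using vx[of l] im eigs_spectral[OF B]
      by (cases "l < i") (auto intro!: mult_right_mono sorted_nth_mono)
  qed
  moreover have "quad_form n B x \<le> quad_form n A x + \<epsilon> * N" unfolding N_def by (rule le) (rule wx)
  ultimately have "eigs n B ! i * N \<le> (eigs n A ! (i + m) + \<epsilon>) * N"
    unfolding sum_distrib_left[symmetric] N1[symmetric] N2[symmetric] by (simp add: algebra_simps)
  with \<open>N > 0\<close> show ?thesis by simp
qed

text \<open>The entry \<open>A i i\<close> is coordinate \<open>i\<close> of \<open>A\<close>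
  applied to the \<open>i\<close>-th unit vector. Expanding that vector in the eigenbasis and
  summing over \<open>i\<close> leaves the eigenvalues, since the \<open>u l\<close> have norm
  one.\<close>

lemma sum_eigs:
  assumes "hermitian_n n A"
  shows "(\<Sum>l<n. eigs n A ! l) = (\<Sum>i<n. Re (A i i))"
proof -
  obtain u where u: "eigenbasis n A (\<lambda>l. of_real (eigs n A ! l)) u" using eigs_spectral[OF assms]
      by blast
  have "A i i = (\<Sum>l<n. of_real (eigs n A ! l) * cnj (u l i) * u l i)" if "i < n" for i
  proof -
    have "apply_mat n A (\<lambda>j. if j = i then 1 else 0) i = A i i"
      using that by (simp add: apply_mat_def if_distrib[of "\<lambda>a. _ * a"] cong: if_cong)
    moreover have "inner_n n (u l) (\<lambda>j. if j = i then 1 else 0) = cnj (u l i)" for l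
      using that by (simp add: inner_n_def if_distrib[of "\<lambda>a. _ * a"] cong: if_cong)
    ultimately show ?thesis using eigenbasis_apply[OF u that, of "\<lambda>j. if j = i then 1 else 0"]
        by simp
  qed
  then have "(\<Sum>i<n. A i i) = (\<Sum>i<n. \<Sum>l<n. of_real (eigs n A ! l) * cnj (u l i) * u l i)" by simp
  also have "\<dots> = (\<Sum>l<n. of_real (eigs n A ! l) * inner_n n (u l) (u l))"
    unfolding inner_n_def sum_distrib_left by (subst sum.swap) (simp add: ac_simps)
  also have "\<dots> = (\<Sum>l<n. of_real (eigs n A ! l))"
    using u by (intro sum.cong refl) (auto simp: eigenbasis_def)
  finally have "Re (\<Sum>i<n. A i i) = Re (\<Sum>l<n. of_real (eigs n A ! l))" by simp
  then show ?thesis by simp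
qed

lemma eigs_eigenvector:
  assumes "hermitian_n n A" "l < n"
  shows "\<exists>x. (\<exists>i<n. x i \<noteq> 0) \<and> (\<forall>i<n. apply_mat n A x i = of_real (eigs n A ! l) * x i)"
proof -
  obtain u where u: "eigenbasis n A (\<lambda>l. of_real (eigs n A ! l)) u"
    using eigs_spectral[OF assms(1)] by blast
  then have "inner_n n (u l) (u l) \<noteq> 0" using assms(2) by (simp add: eigenbasis_def)
  then have "\<exists>i<n. u l i \<noteq> 0" unfolding inner_n_self_eq_0 by blast
  then show ?thesis using u assms(2) by (auto simp: eigenbasis_def)
qed

text \<open>A nonzero \<open>x\<close> has a nonzero coefficient along some \<open>u l\<close>, and
  evaluating \<open>inner_n n (u l) (apply_mat n A x)\<close> from both sides forces
  \<open>z\<close> to be the eigenvalue of that \<open>u l\<close>.\<close>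

lemma eigenvector_in_eigs:
  assumes "hermitian_n n A" "\<exists>i<n. x i \<noteq> 0"
    and ev: "\<forall>i<n. apply_mat n A x i = of_real z * x i"
  shows "\<exists>l<n. eigs n A ! l = z"
proof -
  obtain u where u: "eigenbasis n A (\<lambda>l. of_real (eigs n A ! l)) u"
    using eigs_spectral[OF assms(1)] by blast
  obtain i where "i < n" "x i \<noteq> 0" using assms(2) by blast
  then have "\<exists>l<n. inner_n n (u l) x \<noteq> 0"
    using eigenbasis_expand[OF u \<open>i < n\<close>, of x]
      by (metis (no_types, lifting) lessThan_iff mult_zero_left sum.neutral)
  then obtain l where l: "l < n" "inner_n n (u l) x \<noteq> 0" by blast
  have "of_real z * inner_n n (u l) x = inner_n n (u l) (apply_mat n A x)"
    unfolding inner_n_scale_right[symmetric] using ev by (intro inner_n_cong) auto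
  also have "\<dots> = inner_n n (apply_mat n A (u l)) x" by (rule hermitian_inner[OF assms(1)])
  also have "\<dots> = inner_n n (\<lambda>i. of_real (eigs n A ! l) * u l i) x"
    using u l by (intro inner_n_cong) (auto simp: eigenbasis_def)
  also have "\<dots> = of_real (eigs n A ! l) * inner_n n (u l) x" by (simp add: inner_n_scale_left)
  finally show ?thesis using l by auto
qed

text \<open>\<open>W\<close> is the function 1 / (\<lambda> - z) of \<open>A\<close>, formed in the
  eigenbasis. Both one-sided identities are recorded: the first will give uniqueness and estimates,
  the second existence. Hermiticity makes the diagonal of \<open>W\<close> real.\<close>

lemma hermitian_resolvent:
  assumes "hermitian_n n A" and z: "\<forall>l<n. eigs n A ! l \<noteq> z"
  obtains W where "hermitian_n n W"
    "\<And>x i. i < n \<Longrightarrow> apply_mat n W (\<lambda>j. apply_mat n A x j - of_real z * x j) i = x i"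
    "\<And>x i. i < n \<Longrightarrow> apply_mat n A (apply_mat n W x) i - of_real z * apply_mat n W x i = x i"
proof -
  obtain u where u: "eigenbasis n A (\<lambda>l. of_real (eigs n A ! l)) u"
    using eigs_spectral[OF assms(1)] by blast
  define g where "g l = 1 / (eigs n A ! l - z)" for l
  define W where "W i j = (\<Sum>l<n. of_real (g l) * u l i * cnj (u l j))" for i j
  have W: "apply_mat n W x i = (\<Sum>l<n. of_real (g l) * inner_n n (u l) x * u l i)" for x i
    unfolding apply_mat_def W_def inner_n_def sum_distrib_left sum_distrib_right
    by (subst sum.swap) (simp add: ac_simps)
  have uW: "inner_n n (u l) (apply_mat n W x) = of_real (g l) * inner_n n (u l) x"
      if "l < n" for l x
  proof -
    have "inner_n n (u l) (apply_mat n W x) = (\<Sum>k<n. (of_real (g k) * inner_n n (u k) x)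
        * inner_n n (u l) (u k))"
      unfolding W[abs_def] by (rule inner_n_sum_right)
    also have "\<dots> = (\<Sum>k<n. if l = k then of_real (g k) * inner_n n (u k) x else 0)"
      using u that by (intro sum.cong refl) (auto simp: eigenbasis_def)
    finally show ?thesis using that by simp
  qed
  have gz: "complex_of_real (g l) * (of_real (eigs n A ! l) - of_real z) = 1" if "l < n" for l
    using z that unfolding g_def of_real_diff[symmetric] of_real_mult[symmetric] by simp
  have shift: "inner_n n (u l) (\<lambda>j. apply_mat n A x j - of_real z * x j)
      = (of_real (eigs n A ! l) - of_real z) * inner_n n (u l) x" if "l < n" for l x
  proof -
    have "inner_n n (u l) (apply_mat n A x) = inner_n n (apply_mat n A (u l)) x"
      by (rule hermitian_inner[OF assms(1)])
    also have "\<dots> = inner_n n (\<lambda>i. of_real (eigs n A ! l) * u l i) x"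
      using u that by (intro inner_n_cong) (auto simp: eigenbasis_def)
    finally show ?thesis
      unfolding inner_n_diff_right inner_n_scale_right inner_n_scale_left
        by (simp add: algebra_simps)
  qed
  show thesis
  proof
    show "hermitian_n n W" unfolding hermitian_n_def W_def by (simp add: ac_simps)
    fix x i assume i: "i < n"
    have "apply_mat n W (\<lambda>j. apply_mat n A x j - of_real z * x j) i
      = (\<Sum>l<n. of_real (g l) * (of_real (eigs n A ! l) - of_real z) * inner_n n (u l) x * u l i)"
      unfolding W by (intro sum.cong refl) (simp add: shift mult.assoc)
    also have "\<dots> = (\<Sum>l<n. inner_n n (u l) x * u l i)" by (intro sum.cong refl) (simp add: gz)
    finally show "apply_mat n W (\<lambda>j. apply_mat n A x j - of_real z * x j) i = x i"
      using eigenbasis_expand[OF u i] by simp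
    have "apply_mat n A (apply_mat n W x) i
      = (\<Sum>l<n. of_real (eigs n A ! l) * (of_real (g l) * inner_n n (u l) x) * u l i)"
      unfolding eigenbasis_apply[OF u i] by (intro sum.cong refl) (simp add: uW)
    then have "apply_mat n A (apply_mat n W x) i - of_real z * apply_mat n W x i
      = (\<Sum>l<n. of_real (eigs n A ! l) * (of_real (g l) * inner_n n (u l) x) * u l i)
        - of_real z * (\<Sum>l<n. of_real (g l) * inner_n n (u l) x * u l i)"
      by (simp add: W)
    also have "\<dots> = (\<Sum>l<n. (of_real (g l) * (of_real (eigs n A ! l) - of_real z))
        * (inner_n n (u l) x * u l i))"
      unfolding sum_distrib_left sum_subtractf[symmetric]
        by (intro sum.cong refl) (simp add: algebra_simps)
    also have "\<dots> = (\<Sum>l<n. inner_n n (u l) x * u l i)" by (intro sum.cong refl) (simp add: gz)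
    finally show "apply_mat n A (apply_mat n W x) i - of_real z * apply_mat n W x i = x i"
      using eigenbasis_expand[OF u i] by simp
  qed
qed

section \<open>Floquet matrices of a quotient graph\<close>

lemma pairing_minus: "pairing (- m) \<theta> = - pairing m \<theta>"
  by (simp add: pairing_def sum_negf)

lemma pairing_zero: "pairing 0 \<theta> = 0" "pairing m 0 = 0"
  by (simp_all add: pairing_def)

text \<open>
  The data of a fundamental graph: vertices \<open>{..<n}\<close>, oriented edges \<open>X\<close> with source \<open>s\<close>, target
  \<open>t\<close>, index \<open>\<tau>\<close> and reversal \<open>rv\<close>, and diagonal terms \<open>D\<close> (degree plus potential).
\<close>

locale quotient_graph =
  fixes n :: nat and X :: "'x set" and s t :: "'x \<Rightarrow> nat" and \<tau> :: "'x \<Rightarrow> int ^ 'd"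
    and rv :: "'x \<Rightarrow> 'x" and D :: "nat \<Rightarrow> real"
  assumes finite_X: "finite X"
    and s_less: "c \<in> X \<Longrightarrow> s c < n"
    and rv_in: "c \<in> X \<Longrightarrow> rv c \<in> X"
    and rv_rv: "c \<in> X \<Longrightarrow> rv (rv c) = c"
    and s_rv: "c \<in> X \<Longrightarrow> s (rv c) = t c"
    and \<tau>_rv: "c \<in> X \<Longrightarrow> \<tau> (rv c) = - \<tau> c"
    and loops: "c \<in> X \<Longrightarrow> \<tau> c \<noteq> 0 \<Longrightarrow> s c = t c"
begin

abbreviation phase :: "'x \<Rightarrow> real ^ 'd \<Rightarrow> complex" where
  "phase c \<theta> \<equiv> exp (\<i> * of_real (pairing (\<tau> c) \<theta>))"

definition floq :: "real ^ 'd \<Rightarrow> nat \<Rightarrow> nat \<Rightarrow> complex" where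
  "floq \<theta> j k = (if j = k then of_real (D j) else 0) - (\<Sum>c\<in>{c \<in> X. s c = j \<and> t c = k}. phase c \<theta>)"

definition Br :: "'x set" where "Br = {c \<in> X. \<tau> c \<noteq> 0}"

definition ev :: "nat \<Rightarrow> real ^ 'd \<Rightarrow> real" where "ev i \<theta> = eigs n (floq \<theta>) ! i"

lemma t_less: "c \<in> X \<Longrightarrow> t c < n"
  using s_less[OF rv_in] s_rv by simp

lemma t_rv: "c \<in> X \<Longrightarrow> t (rv c) = s c"
  using s_rv[OF rv_in] rv_rv by simp

lemma finite_Br: "finite Br" and Br_subset: "Br \<subseteq> X"
  using finite_X by (auto simp: Br_def)

text \<open>Reversing edges exchanges the edge sets of the entries \<open>(j, i)\<close> and
  \<open>(i, j)\<close> and negates the indices, which conjugates the phases.\<close>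

lemma hermitian_floq: "hermitian_n n (floq \<theta>)"
  unfolding hermitian_n_def
proof (intro allI impI)
  fix i j assume "i < n" "j < n"
  have "(\<Sum>c\<in>{c \<in> X. s c = j \<and> t c = i}. phase c \<theta>) = (\<Sum>c\<in>{c \<in> X. s c = i \<and> t c
      = j}. cnj (phase c \<theta>))"
    by (rule sum.reindex_bij_witness[of _ rv rv])
      (auto simp: rv_in rv_rv s_rv t_rv \<tau>_rv pairing_minus exp_cnj)
  then show "floq \<theta> j i = cnj (floq \<theta> i j)" by (simp add: floq_def)
qed

lemma apply_floq:
  assumes "j < n"
  shows "apply_mat n (floq \<theta>) x j = of_real (D j) * x j - (\<Sum>c\<in>{c \<in> X. s c = j}. phase c \<theta>
      * x (t c))"
proof -
  have "(\<Sum>k<n. (\<Sum>c\<in>{c \<in> X. s c = j \<and> t c = k}. phase c \<theta>) * x k)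
      = (\<Sum>k<n. \<Sum>c\<in>{c \<in> {c \<in> X. s c = j}. t c = k}. phase c \<theta> * x (t c))"
    unfolding sum_distrib_right by (intro sum.cong) auto
  also have "\<dots> = (\<Sum>c\<in>{c \<in> X. s c = j}. phase c \<theta> * x (t c))"
    using finite_X t_less by (intro sum.group) auto
  finally show ?thesis
    using assms unfolding apply_mat_def floq_def left_diff_distrib sum_subtractf
    by (simp add: if_distrib[of "\<lambda>a. a * _"] cong: if_cong)
qed

lemma quad_form_floq:
  "quad_form n (floq \<theta>) x = (\<Sum>j<n. D j * (cmod (x j))\<^sup>2) - (\<Sum>c\<in>X. Re (cnj (x (s c)) * (phase c \<theta>
      * x (t c))))"
proof -
  have "inner_n n x (apply_mat n (floq \<theta>) x) = (\<Sum>j<n. cnj (x j) * (of_real (D j) * x j))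
      - (\<Sum>j<n. \<Sum>c\<in>{c \<in> X. s c = j}. cnj (x (s c)) * (phase c \<theta> * x (t c)))"
    unfolding inner_n_def sum_subtractf[symmetric]
    by (intro sum.cong refl) (simp add: apply_floq right_diff_distrib sum_distrib_left)
  also have "(\<Sum>j<n. \<Sum>c\<in>{c \<in> X. s c = j}. cnj (x (s c)) * (phase c \<theta> * x (t c)))
      = (\<Sum>c\<in>X. cnj (x (s c)) * (phase c \<theta> * x (t c)))"
    using finite_X s_less by (intro sum.group) auto
  also have "(\<Sum>j<n. cnj (x j) * (of_real (D j) * x j)) = of_real (\<Sum>j<n. D j * (cmod (x j))\<^sup>2)"
    unfolding of_real_sum of_real_mult complex_norm_square
      by (intro sum.cong refl) (simp add: ac_simps)
  finally show ?thesis by (simp add: quad_form_def)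
qed

text \<open>Edges of index zero have phase 1 for every \<theta> and cancel. A bridge is a loop, so
  its term is the phase times \<open>(cmod (x (s c)))\<^sup>2\<close>, with the cosine as real
  factor.\<close>

lemma quad_form_diff:
  "quad_form n (floq \<theta>) x = quad_form n (floq \<theta>') x
    + (\<Sum>c\<in>Br. (cos (pairing (\<tau> c) \<theta>') - cos (pairing (\<tau> c) \<theta>)) * (cmod (x (s c)))\<^sup>2)"
proof -
  have "(\<Sum>c\<in>X. Re (cnj (x (s c)) * (phase c \<theta>' * x (t c)))) - (\<Sum>c\<in>X. Re (cnj (x (s c))
      * (phase c \<theta> * x (t c))))
    = (\<Sum>c\<in>X. Re (cnj (x (s c)) * (phase c \<theta>' * x (t c))) - Re (cnj (x (s c)) * (phase c \<theta> * x (t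
        c))))"
    by (rule sum_subtractf[symmetric])
  also have "\<dots> = (\<Sum>c\<in>Br. (cos (pairing (\<tau> c) \<theta>') - cos (pairing (\<tau> c) \<theta>)) * (cmod (x (s c)))\<^sup>2)"
  proof (intro sum.mono_neutral_cong_right)
    fix c assume c: "c \<in> Br"
    then have st: "t c = s c" using loops by (auto simp: Br_def)
    have "Re (cnj (x (s c)) * (phase c \<theta> * x (t c))) = Re (phase c \<theta>
        * of_real ((cmod (x (s c)))\<^sup>2))" for \<theta>
      unfolding st cmod_power2 by (simp add: power2_eq_square algebra_simps)
    then show "Re (cnj (x (s c)) * (phase c \<theta>' * x (t c))) - Re (cnj (x (s c)) * (phase c \<theta>
        * x (t c)))
      = (cos (pairing (\<tau> c) \<theta>') - cos (pairing (\<tau> c) \<theta>)) * (cmod (x (s c)))\<^sup>2"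
      by (simp add: Re_exp left_diff_distrib)
  qed (auto simp: finite_X Br_def pairing_zero)
  finally show ?thesis unfolding quad_form_floq by simp
qed

text \<open>Min-max for two quasimomenta. The codimension \<open>m\<close> serves interlacing and
  the error \<open>\<epsilon>\<close> serves continuity; monotonicity takes both to be zero.\<close>

lemma ev_le:
  assumes "i + m < n"
    and "\<And>x. (\<And>k. k < m \<Longrightarrow> inner_n n (w k) x = 0) \<Longrightarrow>
      (\<Sum>c\<in>Br. (cos (pairing (\<tau> c) \<theta>') - cos (pairing (\<tau> c) \<theta>)) * (cmod (x (s c)))\<^sup>2)
        \<le> \<epsilon> * (\<Sum>i<n. (cmod (x i))\<^sup>2)"
  shows "ev i \<theta> \<le> ev (i + m) \<theta>' + \<epsilon>"
  unfolding ev_def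
  by (rule eigs_le[OF hermitian_floq hermitian_floq assms(1), of w], subst
    quad_form_diff[of _ _ \<theta>'])
    (use assms(2) in auto)

lemma ev_mono:
  assumes "i < n" "\<And>c. c \<in> Br \<Longrightarrow> cos (pairing (\<tau> c) \<theta>') \<le> cos (pairing (\<tau> c) \<theta>)"
  shows "ev i \<theta> \<le> ev i \<theta>'"
proof -
  have "ev i \<theta> \<le> ev (i + 0) \<theta>' + 0"
    using assms by (intro ev_le) (auto intro!: sum_nonpos simp: mult_le_0_iff)
  then show ?thesis by simp
qed

lemma ev_zero_le: "i < n \<Longrightarrow> ev i 0 \<le> ev i \<theta>"
  by (rule ev_mono) (auto simp: pairing_zero)

text \<open>Rank-one interlacing: the single constraint is orthogonality to the \<open>k\<close>-th
  unit vector. It forces \<open>x k = 0\<close>, and then all bridge terms vanish, whatever the two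
  quasimomenta are.\<close>

lemma ev_interlace:
  assumes "Suc i < n" "\<And>c. c \<in> Br \<Longrightarrow> s c = k" "k < n"
  shows "ev i \<theta> \<le> ev (Suc i) \<theta>'"
proof -
  have "ev i \<theta> \<le> ev (i + 1) \<theta>' + 0"
  proof (rule ev_le[of _ _ "\<lambda>_ j. if j = k then 1 else 0"])
    fix x :: "nat \<Rightarrow> complex"
    assume "\<And>l :: nat. l < 1 \<Longrightarrow> inner_n n (\<lambda>j. if j = k then 1 else 0) x = 0"
    from this[of 0] have "x k = 0"
      using assms(3) by (simp add: inner_n_def if_distrib[of "\<lambda>a. a * _"] if_distrib[of cnj] cong:
        if_cong)
    then show "(\<Sum>c\<in>Br. (cos (pairing (\<tau> c) \<theta>') - cos (pairing (\<tau> c) \<theta>)) * (cmod (x (s c)))\<^sup>2)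
        \<le> 0 * (\<Sum>i<n. (cmod (x i))\<^sup>2)" using assms(2) by simp
  qed (use assms in auto)
  then show ?thesis by simp
qed

text \<open>One coordinate of \<open>x\<close> is at most the whole norm, so the two forms differ by
  at most this sum times the squared norm. The sum tends to 0 as \<theta> tends to \<theta>', which
  gives continuity without perturbation theory of polynomial roots.\<close>

lemma ev_diff_le:
  assumes "i < n"
  shows "ev i \<theta> \<le> ev i \<theta>' + (\<Sum>c\<in>Br. \<bar>cos (pairing (\<tau> c) \<theta>') - cos (pairing (\<tau> c) \<theta>)\<bar>)"
proof -
  have "ev i \<theta> \<le> ev (i + 0) \<theta>' + (\<Sum>c\<in>Br. \<bar>cos (pairing (\<tau> c) \<theta>') - cos (pairing (\<tau> c) \<theta>)\<bar>)"
  proof (rule ev_le)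
    fix x :: "nat \<Rightarrow> complex"
    show "(\<Sum>c\<in>Br. (cos (pairing (\<tau> c) \<theta>') - cos (pairing (\<tau> c) \<theta>)) * (cmod (x (s c)))\<^sup>2)
        \<le> (\<Sum>c\<in>Br. \<bar>cos (pairing (\<tau> c) \<theta>') - cos (pairing (\<tau> c) \<theta>)\<bar>) * (\<Sum>i<n. (cmod (x i))\<^sup>2)"
      unfolding sum_distrib_right
    proof (intro sum_mono mult_mono)
      fix c assume "c \<in> Br"
      then show "(cmod (x (s c)))\<^sup>2 \<le> (\<Sum>i<n. (cmod (x i))\<^sup>2)"
        using s_less Br_subset by (intro member_le_sum) auto
    qed auto
  qed (use assms in auto)
  then show ?thesis by simp
qed

lemma continuous_ev:
  assumes "i < n"
  shows "continuous_on UNIV (ev i)"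
  unfolding continuous_on_def
proof (intro ballI)
  fix \<theta>' :: "real ^ 'd"
  define g where "g \<theta> = (\<Sum>c\<in>Br. \<bar>cos (pairing (\<tau> c) \<theta>') - cos (pairing (\<tau> c) \<theta>)\<bar>)" for \<theta>
  have "((\<lambda>\<theta>. pairing m \<theta>) \<longlongrightarrow> pairing m \<theta>') (at \<theta>')" for m
    unfolding pairing_def by (intro tendsto_intros tendsto_vec_nth)
  then have "(g \<longlongrightarrow> (\<Sum>c\<in>Br. \<bar>cos (pairing (\<tau> c) \<theta>') - cos (pairing (\<tau> c) \<theta>')\<bar>)) (at \<theta>')"
    unfolding g_def by (intro tendsto_intros)
  then have g: "(g \<longlongrightarrow> 0) (at \<theta>')" by simp
  have "norm (ev i \<theta> - ev i \<theta>') \<le> g \<theta>" for \<theta>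
    using ev_diff_le[OF assms, of \<theta> \<theta>'] ev_diff_le[OF assms, of \<theta>' \<theta>]
    unfolding g_def by (simp add: abs_le_iff abs_minus_commute)
  then have "((\<lambda>\<theta>. ev i \<theta> - ev i \<theta>') \<longlongrightarrow> 0) (at \<theta>')"
    by (intro Lim_null_comparison[OF _ g]) auto
  then show "(ev i \<longlongrightarrow> ev i \<theta>') (at \<theta>' within UNIV)" using LIM_zero_cancel by blast
qed

text \<open>The subtraction moves \<theta> into the cube with sides [0, 2 pi], and indices are
  integral, so the phases do not change. This supplies the compactness of the torus.\<close>

lemma ev_periodic: "ev i \<theta> = ev i (\<chi> r. \<theta> $ r - 2 * pi * of_int \<lfloor>\<theta> $ r / (2 * pi)\<rfloor>)"
proof -
  define \<theta>' where "\<theta>' = (\<chi> r. \<theta> $ r - 2 * pi * of_int \<lfloor>\<theta> $ r / (2 * pi)\<rfloor>)"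
  have "phase c \<theta> = phase c \<theta>'" for c
  proof -
    define N where "N = (\<Sum>r\<in>UNIV. \<tau> c $ r * \<lfloor>\<theta> $ r / (2 * pi)\<rfloor>)"
    have "pairing (\<tau> c) \<theta>' = pairing (\<tau> c) \<theta> - 2 * pi * of_int N"
      unfolding pairing_def \<theta>'_def N_def
      by (simp add: right_diff_distrib sum_subtractf sum_distrib_left ac_simps)
    then have "pairing (\<tau> c) \<theta> = pairing (\<tau> c) \<theta>' + 2 * pi * of_int N" by simp
    then have "\<i> * complex_of_real (pairing (\<tau> c) \<theta>) = \<i> * of_real (pairing (\<tau> c) \<theta>')
        + of_real (of_int (2 * N) * pi) * \<i>"
      by (simp add: algebra_simps)
    then show ?thesis unfolding exp_eq by auto
  qed
  then have "floq \<theta> = floq \<theta>'" by (simp add: floq_def fun_eq_iff)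
  then show ?thesis unfolding \<theta>'_def[symmetric] ev_def by simp
qed

lemma band_interval:
  assumes "i < n"
  shows "range (ev i) = {Inf (range (ev i))..Sup (range (ev i))}" "compact (range (ev i))"
proof -
  have "range (ev i) = ev i ` cbox 0 (\<chi> r. 2 * pi)"
  proof (intro equalityI subsetI)
    fix y assume "y \<in> range (ev i)"
    then obtain \<theta> where y: "y = ev i \<theta>" by blast
    have "0 \<le> \<theta> $ r - 2 * pi * of_int \<lfloor>\<theta> $ r / (2 * pi)\<rfloor> \<and> \<theta> $ r - 2 * pi * of_int \<lfloor>\<theta> $ r / (2
        * pi)\<rfloor> \<le> 2 * pi" for r
      using floor_divide_lower[of "2 * pi" "\<theta> $ r"] floor_divide_upper[of "2 * pi" "\<theta> $ r"]
      by (simp add: algebra_simps)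
    then have "(\<chi> r. \<theta> $ r - 2 * pi * of_int \<lfloor>\<theta> $ r / (2 * pi)\<rfloor>) \<in> cbox 0 (\<chi> r. 2 * pi)"
      by (simp add: mem_box_cart)
    then show "y \<in> ev i ` cbox 0 (\<chi> r. 2 * pi)" unfolding y by (subst ev_periodic) blast
  qed auto
  then show compact: "compact (range (ev i))"
    using continuous_ev[OF assms] by (metis compact_cbox compact_continuous_image
      continuous_on_subset subset_UNIV)
  moreover have "connected (range (ev i))"
    using continuous_ev[OF assms] by (intro connected_continuous_image) auto
  ultimately obtain a b where ab: "range (ev i) = {a..b}" using connected_compact_interval_1
      by blast
  \<comment> \<open>The band is nonempty, which excludes the empty interval, for which
    \<open>Inf\<close> and \<open>Sup\<close> would not return the end points.\<close>
  then have "a \<le> b" by (metis atLeastatMost_empty_iff UNIV_not_empty empty_is_image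
      not_le_imp_less order_less_imp_le)
  then show "range (ev i) = {Inf (range (ev i))..Sup (range (ev i))}" unfolding ab by simp
qed

lemma Inf_band:
  assumes "i < n"
  shows "Inf (range (ev i)) = ev i 0"
  by (rule cInf_eq_minimum) (use ev_zero_le[OF assms] in auto)

lemma Sup_band:
  assumes "i < n" "\<And>c. c \<in> Br \<Longrightarrow> cos (pairing (\<tau> c) \<theta>\<^sub>0) = -1"
  shows "Sup (range (ev i)) = ev i \<theta>\<^sub>0"
  by (rule cSup_eq_maximum) (use ev_mono[OF assms(1), of \<theta>\<^sub>0] assms(2) in auto)

lemma band_eq:
  assumes "i < n" "\<And>c. c \<in> Br \<Longrightarrow> cos (pairing (\<tau> c) \<theta>\<^sub>0) = -1"
  shows "range (ev i) = {ev i 0..ev i \<theta>\<^sub>0}"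
  using band_interval(1)[OF assms(1)] Inf_band[OF assms(1)] Sup_band[OF assms] by simp

text \<open>The trace. Only loops of the fundamental graph reach the diagonal; those of index zero
  are included and contribute a cosine of 1.\<close>

lemma sum_ev: "(\<Sum>i<n. ev i \<theta>) = (\<Sum>j<n. D j) - (\<Sum>c\<in>{c \<in> X. s c = t c}. cos (pairing (\<tau> c) \<theta>))"
proof -
  have "(\<Sum>i<n. ev i \<theta>) = (\<Sum>j<n. D j - (\<Sum>c\<in>{c \<in> {c \<in> X. s c = t c}. s c
      = j}. cos (pairing (\<tau> c) \<theta>)))"
    unfolding ev_def sum_eigs[OF hermitian_floq] floq_def
    by (intro sum.cong refl) (auto simp: Re_exp intro!: sum.cong)
  also have "\<dots> = (\<Sum>j<n. D j) - (\<Sum>c\<in>{c \<in> X. s c = t c}. cos (pairing (\<tau> c) \<theta>))"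
    unfolding sum_subtractf using finite_X s_less t_less by (subst sum.group) auto
  finally show ?thesis .
qed

text \<open>In the difference of the traces at \<open>\<theta>\<^sub>0\<close> and 0, the diagonal
  terms and the loops of index zero cancel, and each oriented bridge leaves 1 - (-1).\<close>

lemma sum_measure_bands:
  assumes "\<And>c. c \<in> Br \<Longrightarrow> cos (pairing (\<tau> c) \<theta>\<^sub>0) = -1"
  shows "(\<Sum>i<n. measure lebesgue (range (ev i))) = 2 * real (card Br)"
proof -
  have "(\<Sum>i<n. measure lebesgue (range (ev i))) = (\<Sum>i<n. ev i \<theta>\<^sub>0 - ev i 0)"
    using band_eq[OF _ assms] ev_zero_le by (intro sum.cong refl) simp
  also have "\<dots> = (\<Sum>c\<in>{c \<in> X. s c = t c}. 1 - cos (pairing (\<tau> c) \<theta>\<^sub>0))"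
    unfolding sum_subtractf sum_ev by (simp add: pairing_zero)
  also have "\<dots> = (\<Sum>c\<in>Br. 2)"
    using loops assms by (intro sum.mono_neutral_cong_right) (auto simp: finite_X Br_def
      pairing_zero)
  finally show ?thesis by simp
qed

text \<open>By interlacing, the top of a band is at most the bottom of the next one, so two bands
  share at most an end point and their measures add.\<close>

lemma measure_Union_bands:
  assumes "\<And>c. c \<in> Br \<Longrightarrow> cos (pairing (\<tau> c) \<theta>\<^sub>0) = -1"
    and "\<And>c. c \<in> Br \<Longrightarrow> s c = k" "k < n"
  shows "measure lebesgue (\<Union>i<n. range (ev i)) = (\<Sum>i<n. measure lebesgue (range (ev i)))"
proof (rule measure_negligible_finite_Union_image)
  show "range (ev i) \<in> lmeasurable" if "i \<in> {..<n}" for i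
    using that band_interval(2) by (simp add: lmeasurable_compact)
  have less: "negligible (range (ev i) \<inter> range (ev j))" if "i < j" "j < n" for i j
  proof -
    have "ev i \<theta>\<^sub>0 \<le> ev (Suc i) 0" using that assms by (intro ev_interlace[of i k]) auto
    also have "\<dots> \<le> ev j 0"
      unfolding ev_def using that eigs_spectral[OF hermitian_floq] by (intro sorted_nth_mono) auto
    finally have "range (ev i) \<inter> range (ev j) \<subseteq> {ev j 0}"
      using band_eq[OF _ assms(1)] that by auto
    then show ?thesis by (meson negligible_sing negligible_subset)
  qed
  show "pairwise (\<lambda>i j. negligible (range (ev i) \<inter> range (ev j))) {..<n}"
    unfolding pairwise_def using less by (metis Int_commute lessThan_iff linorder_neqE_nat)
qed simp

end

section \<open>Square summable functions\<close>

text \<open>Membership in \<open>ell2 J\<close> with norm at most \<open>C\<close>, stated through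
  finite partial sums. Estimates thus reduce to Minkowski's inequality for finite sums, and
  summability is dealt with only on conversion to \<open>ell2\<close>.\<close>

definition l2_bounded :: "'v set \<Rightarrow> ('v \<Rightarrow> complex) \<Rightarrow> real \<Rightarrow> bool" where
  "l2_bounded J f C \<longleftrightarrow> (\<forall>v. v \<notin> J \<longrightarrow> f v = 0) \<and>
     (\<forall>F. finite F \<longrightarrow> F \<subseteq> J \<longrightarrow> L2_set (\<lambda>v. cmod (f v)) F \<le> C)"

lemma l2_boundedI:
  "(\<And>v. v \<notin> J \<Longrightarrow> f v = 0) \<Longrightarrow> (\<And>F. finite F \<Longrightarrow> F \<subseteq> J \<Longrightarrow> L2_set (\<lambda>v. cmod (f v)) F \<le> C) \<Longrightarrow>
    l2_bounded J f C"
  by (auto simp: l2_bounded_def)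

lemma l2_boundedD:
  assumes "l2_bounded J f C"
  shows "v \<notin> J \<Longrightarrow> f v = 0" "finite F \<Longrightarrow> F \<subseteq> J \<Longrightarrow> L2_set (\<lambda>v. cmod (f v)) F \<le> C"
  using assms by (auto simp: l2_bounded_def)

lemma l2_bounded_nonneg: "l2_bounded J f C \<Longrightarrow> 0 \<le> C"
  using l2_boundedD(2)[of J f C "{}"] by simp

lemma l2_bounded_mono: "l2_bounded J f C \<Longrightarrow> C \<le> C' \<Longrightarrow> l2_bounded J f C'"
  unfolding l2_bounded_def by (meson order_trans)

lemma l2_bounded_point: 
  assumes "l2_bounded J f C"
  shows "cmod (f v) \<le> C"
proof (cases "v \<in> J")
  case True
  then show ?thesis using l2_boundedD(2)[OF assms, of "{v}"] by simp
next
  case False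
  then show ?thesis using l2_boundedD(1)[OF assms] l2_bounded_nonneg[OF assms] by simp
qed

lemma l2_bounded_ell2:
  assumes "f \<in> ell2 J"
  shows "l2_bounded J f (ell2_norm J f)"
proof (rule l2_boundedI)
  fix F assume F: "finite F" "F \<subseteq> J"
  then have "(\<Sum>v\<in>F. (cmod (f v))\<^sup>2) \<le> (\<Sum>\<^sub>\<infinity>v\<in>J. (cmod (f v))\<^sup>2)"
    using assms by (intro finite_sum_le_infsum) (auto simp: ell2_def)
  then show "L2_set (\<lambda>v. cmod (f v)) F \<le> ell2_norm J f"
    unfolding L2_set_def ell2_norm_def by simp
qed (use assms in \<open>auto simp: ell2_def\<close>)

lemma ell2_norm_nonneg: "f \<in> ell2 J \<Longrightarrow> 0 \<le> ell2_norm J f"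
  using l2_bounded_ell2 l2_bounded_nonneg by blast

lemma l2_bounded_imp_ell2:
  assumes "l2_bounded J f C"
  shows "f \<in> ell2 J" "ell2_norm J f \<le> C"
proof -
  have bound: "(\<Sum>v\<in>F. (cmod (f v))\<^sup>2) \<le> C\<^sup>2" if "finite F" "F \<subseteq> J" for F
    using l2_boundedD(2)[OF assms that] unfolding L2_set_def by (rule sqrt_le_D)
  then have summable: "(\<lambda>v. (cmod (f v))\<^sup>2) summable_on J"
    by (intro nonneg_bdd_above_summable_on bdd_aboveI[of _ "C\<^sup>2"]) auto
  then show "f \<in> ell2 J" using l2_boundedD(1)[OF assms] by (auto simp: ell2_def)
  have "(\<Sum>\<^sub>\<infinity>v\<in>J. (cmod (f v))\<^sup>2) \<le> C\<^sup>2"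
    using bound by (intro infsum_le_finite_sums[OF summable]) auto
  then show "ell2_norm J f \<le> C"
    unfolding ell2_norm_def using l2_bounded_nonneg[OF assms] by (simp add: real_le_lsqrt)
qed

lemma l2_bounded_dominated:
  assumes "l2_bounded J f C" "\<And>v. v \<notin> J \<Longrightarrow> g v = 0" "\<And>v. v \<in> J \<Longrightarrow> cmod (g v) \<le> cmod (f v)"
  shows "l2_bounded J g C"
proof (rule l2_boundedI)
  fix F assume F: "finite F" "F \<subseteq> J"
  then have "L2_set (\<lambda>v. cmod (g v)) F \<le> L2_set (\<lambda>v. cmod (f v)) F"
    using assms(3) by (intro L2_set_mono) auto
  then show "L2_set (\<lambda>v. cmod (g v)) F \<le> C" using l2_boundedD(2)[OF assms(1) F] by simp
qed (use assms in auto)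

lemma l2_bounded_add:
  assumes "l2_bounded J f C" "l2_bounded J g C'"
  shows "l2_bounded J (\<lambda>v. f v + g v) (C + C')"
proof (rule l2_boundedI)
  fix F assume F: "finite F" "F \<subseteq> J"
  have "L2_set (\<lambda>v. cmod (f v + g v)) F \<le> L2_set (\<lambda>v. cmod (f v) + cmod (g v)) F"
    by (intro L2_set_mono) (auto simp: norm_triangle_ineq)
  also have "\<dots> \<le> L2_set (\<lambda>v. cmod (f v)) F + L2_set (\<lambda>v. cmod (g v)) F"
      by (rule L2_set_triangle_ineq)
  also have "\<dots> \<le> C + C'" using l2_boundedD(2)[OF assms(1) F] l2_boundedD(2)[OF assms(2) F] by simp
  finally show "L2_set (\<lambda>v. cmod (f v + g v)) F \<le> C + C'" .
qed (use l2_boundedD(1)[OF assms(1)] l2_boundedD(1)[OF assms(2)] in auto)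

lemma l2_bounded_scale:
  assumes "l2_bounded J f C"
  shows "l2_bounded J (\<lambda>v. z * f v) (cmod z * C)"
proof (rule l2_boundedI)
  fix F assume F: "finite F" "F \<subseteq> J"
  show "L2_set (\<lambda>v. cmod (z * f v)) F \<le> cmod z * C"
    using l2_boundedD(2)[OF assms F]
    by (simp add: norm_mult L2_set_right_distrib[symmetric] mult_left_mono)
qed (use l2_boundedD(1)[OF assms] in auto)

lemma l2_bounded_zero: "l2_bounded J (\<lambda>v. 0) 0"
  by (simp add: l2_bounded_def L2_set_0')

lemma l2_bounded_sum:
  assumes "finite S" "\<And>c. c \<in> S \<Longrightarrow> l2_bounded J (f c) (C c)"
  shows "l2_bounded J (\<lambda>v. \<Sum>c\<in>S. f c v) (\<Sum>c\<in>S. C c)"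
  using assms by (induction S) (simp_all add: l2_bounded_zero l2_bounded_add)

text \<open>An injective substitution only selects and rearranges values. Lattice shifts,
  restriction to a component and relabelling of vertices are all instances.\<close>

lemma l2_bounded_reindex:
  assumes "l2_bounded J f C" "inj_on h I" "h ` I \<subseteq> J" "I \<subseteq> I'"
  shows "l2_bounded I' (\<lambda>v. if v \<in> I then f (h v) else 0) C"
proof (rule l2_boundedI)
  fix F assume F: "finite F" "F \<subseteq> I'"
  have "(\<Sum>v\<in>F. (cmod (if v \<in> I then f (h v) else 0))\<^sup>2) = (\<Sum>v\<in>F \<inter> I. (cmod (f (h v)))\<^sup>2)"
    using F by (intro sum.mono_neutral_cong_right) auto
  also have "\<dots> = (\<Sum>v\<in>h ` (F \<inter> I). (cmod (f v))\<^sup>2)"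
    using assms(2) by (subst sum.reindex) (auto intro: inj_on_subset)
  finally have "L2_set (\<lambda>v. cmod (if v \<in> I then f (h v) else 0)) F
      = L2_set (\<lambda>v. cmod (f v)) (h ` (F \<inter> I))"
    by (simp add: L2_set_def)
  also have "\<dots> \<le> C" using F assms(3) by (intro l2_boundedD(2)[OF assms(1)]) auto
  finally show "L2_set (\<lambda>v. cmod (if v \<in> I then f (h v) else 0)) F \<le> C" .
qed (use assms in auto)

text \<open>Bounds over finite sets pass to pointwise limits. This stands in for completeness of
  \<open>ell2\<close> when the Neumann series is summed.\<close>

lemma l2_bounded_limit:
  assumes "\<And>p. l2_bounded J (f p) C" "\<And>v. v \<notin> J \<Longrightarrow> g v = 0" "\<And>v. (\<lambda>p. f p v) \<longlonglongrightarrow> g v"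
  shows "l2_bounded J g C"
proof (rule l2_boundedI)
  fix F assume F: "finite F" "F \<subseteq> J"
  have "(\<lambda>p. L2_set (\<lambda>v. cmod (f p v)) F) \<longlonglongrightarrow> L2_set (\<lambda>v. cmod (g v)) F"
    unfolding L2_set_def using assms(3) by (intro tendsto_intros)
  then show "L2_set (\<lambda>v. cmod (g v)) F \<le> C"
    by (rule LIMSEQ_le_const2) (use l2_boundedD(2)[OF assms(1) F] in blast)
qed (use assms in auto)

section \<open>Resolvent sets and their invariance under relabelling\<close>

definition l2_resolvent :: "'v set \<Rightarrow> (('v \<Rightarrow> complex) \<Rightarrow> 'v \<Rightarrow> complex) \<Rightarrow> bool" where
  "l2_resolvent J R \<longleftrightarrow> bij_betw R (ell2 J) (ell2 J) \<and>
     (\<exists>C. \<forall>f\<in>ell2 J. ell2_norm J f \<le> C * ell2_norm J (R f))"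

lemma ell2_spectrum_iff: "z \<in> ell2_spectrum J T \<longleftrightarrow> \<not> l2_resolvent J (\<lambda>f v. T f v - z * f v)"
  by (simp add: ell2_spectrum_def l2_resolvent_def)

definition pull :: "'i set \<Rightarrow> ('i \<Rightarrow> 'v) \<Rightarrow> ('v \<Rightarrow> complex) \<Rightarrow> 'i \<Rightarrow> complex" where
  "pull I h f i = (if i \<in> I then f (h i) else 0)"

lemma pull_ell2:
  assumes "inj_on h I" "h ` I \<subseteq> J" "f \<in> ell2 J"
  shows "pull I h f \<in> ell2 I" "ell2_norm I (pull I h f) \<le> ell2_norm J f"
proof -
  have "l2_bounded I (\<lambda>v. if v \<in> I then f (h v) else 0) (ell2_norm J f)"
    using assms by (intro l2_bounded_reindex[OF l2_bounded_ell2]) auto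
  then have "l2_bounded I (pull I h f) (ell2_norm J f)" by (simp add: pull_def[abs_def])
  then show "pull I h f \<in> ell2 I" "ell2_norm I (pull I h f) \<le> ell2_norm J f"
    using l2_bounded_imp_ell2 by auto
qed

lemma l2_resolvent_transfer:
  assumes h: "bij_betw h I J" and R': "l2_resolvent I R'"
    and R: "\<And>f i. f \<in> ell2 J \<Longrightarrow> i \<in> I \<Longrightarrow> R f (h i) = R' (pull I h f) i"
    and R0: "\<And>f v. f \<in> ell2 J \<Longrightarrow> v \<notin> J \<Longrightarrow> R f v = 0"
  shows "l2_resolvent J R"
proof -
  define h' where "h' = inv_into I h"
  have h': "bij_betw h' J I" unfolding h'_def by (rule bij_betw_inv_into[OF h])
  have hh': "h' (h i) = i" if "i \<in> I" for i
    using that h unfolding h'_def by (auto simp: bij_betw_def)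
  have h'h: "h (h' v) = v" if "v \<in> J" for v
    using that h unfolding h'_def by (auto simp: bij_betw_def f_inv_into_f)
  have mem: "h' v \<in> I" if "v \<in> J" for v
    using that h' by (auto simp: bij_betw_def)
  have inj: "inj_on h I" "h ` I \<subseteq> J" "inj_on h' J" "h' ` J \<subseteq> I"
    using h h' by (auto simp: bij_betw_def)
  note down = pull_ell2[OF inj(1,2)] and up = pull_ell2[OF inj(3,4)]
  have ud: "pull J h' (pull I h f) = f" if "f \<in> ell2 J" for f
    using that inj by (auto simp: pull_def fun_eq_iff h'h ell2_def)
  have du: "pull I h (pull J h' g) = g" if "g \<in> ell2 I" for g
    using that inj by (auto simp: pull_def fun_eq_iff hh' ell2_def)
  have bij: "bij_betw (pull I h) (ell2 J) (ell2 I)"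
    by (rule bij_betw_byWitness[where f' = "pull J h'"]) (use down(1) up(1) ud du in blast)+
  have bij': "bij_betw (pull J h') (ell2 I) (ell2 J)"
    by (rule bij_betw_byWitness[where f' = "pull I h"]) (use down(1) up(1) ud du in blast)+
  have R_eq: "R f = pull J h' (R' (pull I h f))" if "f \<in> ell2 J" for f
  proof
    fix v show "R f v = pull J h' (R' (pull I h f)) v"
      using R[OF that, of "h' v"] R0[OF that, of v] mem h'h by (auto simp: pull_def)
  qed
  obtain C where bij_R': "bij_betw R' (ell2 I) (ell2 I)"
    and C: "\<And>g. g \<in> ell2 I \<Longrightarrow> ell2_norm I g \<le> C * ell2_norm I (R' g)"
    using R' by (auto simp: l2_resolvent_def)
  have "bij_betw (pull J h' \<circ> (R' \<circ> pull I h)) (ell2 J) (ell2 J)"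
    by (rule bij_betw_trans[OF bij_betw_trans[OF bij bij_R'] bij'])
  then have "bij_betw R (ell2 J) (ell2 J)"
    by (subst bij_betw_cong[of _ R "pull J h' \<circ> (R' \<circ> pull I h)"]) (auto simp: R_eq)
  \<comment> \<open>\<open>C\<close> has no prescribed sign; its absolute value keeps the estimate
    monotone in the norm.\<close>
  moreover have "ell2_norm J f \<le> \<bar>C\<bar> * ell2_norm J (R f)" if f: "f \<in> ell2 J" for f
  proof -
    let ?g = "pull I h f"
    have g: "?g \<in> ell2 I" using down f by blast
    have R'g: "R' ?g \<in> ell2 I" using bij_R' g by (auto simp: bij_betw_def)
    have "ell2_norm J f = ell2_norm J (pull J h' ?g)" using ud f by simp
    also have "\<dots> \<le> ell2_norm I ?g" using up g by blast
    also have "\<dots> \<le> C * ell2_norm I (R' ?g)" by (rule C[OF g])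
    also have "\<dots> \<le> \<bar>C\<bar> * ell2_norm I (R' ?g)" using ell2_norm_nonneg[OF R'g]
        by (intro mult_right_mono) auto
    also have "R' ?g = pull I h (R f)" using du[OF R'g] R_eq[OF f] by simp
    also have "ell2_norm I (pull I h (R f)) \<le> ell2_norm J (R f)"
      using down up R'g R_eq[OF f] by metis
    finally show ?thesis by (simp add: mult_left_mono)
  qed
  ultimately show ?thesis unfolding l2_resolvent_def by blast
qed

text \<open>Conjugation by the unitary map \<open>pull\<close>. The converse implication is the same
  transfer along the inverse bijection; off the index sets both operators vanish, in keeping with
  the extension by zero.\<close>

lemma ell2_spectrum_transfer:
  assumes h: "bij_betw h I J"
    and T: "\<And>f i. i \<in> I \<Longrightarrow> T f (h i) = T' (pull I h f) i"
    and T0: "\<And>f v. v \<notin> J \<Longrightarrow> T f v = 0" "\<And>f i. i \<notin> I \<Longrightarrow> T' f i = 0"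
  shows "ell2_spectrum J T = ell2_spectrum I T'"
proof -
  have "l2_resolvent J (\<lambda>f v. T f v - z * f v) \<longleftrightarrow> l2_resolvent I (\<lambda>f v. T' f v - z * f v)" for z
  proof
    assume "l2_resolvent I (\<lambda>f v. T' f v - z * f v)"
    then show "l2_resolvent J (\<lambda>f v. T f v - z * f v)"
      by (rule l2_resolvent_transfer[OF h]) (auto simp: T T0 pull_def ell2_def)
  next
    assume "l2_resolvent J (\<lambda>f v. T f v - z * f v)"
    then show "l2_resolvent I (\<lambda>f v. T' f v - z * f v)"
    proof (rule l2_resolvent_transfer[OF bij_betw_inv_into[OF h]])
      fix f v assume f: "f \<in> ell2 I" and v: "v \<in> J"
      let ?i = "inv_into I h v"
      have i: "?i \<in> I" "h ?i = v" using v h by (auto simp: bij_betw_def inv_into_into f_inv_into_f)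
      have "pull I h (pull J (inv_into I h) f) = f"
        using f h by (auto simp: pull_def fun_eq_iff ell2_def bij_betw_def)
      then have "T' f ?i = T (pull J (inv_into I h) f) v"
        using T[OF i(1), of "pull J (inv_into I h) f"] i by simp
      then show "T' f ?i - z * f ?i = T (pull J (inv_into I h) f) v - z * pull J (inv_into I h) f v"
        using v by (simp add: pull_def)
    qed (auto simp: T0 ell2_def)
  qed
  then show ?thesis by (auto simp: ell2_spectrum_iff)
qed

section \<open>The spectrum of the lattice operator\<close>

text \<open>The 1-norm in the exponent lets the function factor over the coordinates, and a
  translation changes it by a bounded factor only.\<close>

definition decay :: "real \<Rightarrow> int ^ 'd \<Rightarrow> real" where
  "decay \<epsilon> m = exp (- \<epsilon> * (\<Sum>r\<in>UNIV. real_of_int \<bar>m $ r\<bar>))"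

lemma decay_pos: "0 < decay \<epsilon> m"
  by (simp add: decay_def)

text \<open>Two geometric series, over the nonnegative and over the nonpositive integers; 0 is
  counted twice, which only weakens the bound.\<close>

lemma sum_decay_int:
  assumes "\<epsilon> > 0"
  shows "(\<Sum>k\<in>{- int N..int N}. exp (- \<epsilon> * real_of_int \<bar>k\<bar>)) \<le> 2 / (1 - exp (- \<epsilon>))"
proof -
  have q: "0 < exp (- \<epsilon>)" "exp (- \<epsilon>) < 1" using assms by auto
  have half: "(\<Sum>k\<in>S. exp (- \<epsilon> * real_of_int \<bar>k\<bar>)) \<le> 1 / (1 - exp (- \<epsilon>))"
    if "S = g ` {..N}" "inj_on g {..N}" "\<And>k. \<bar>g k\<bar> = int k" for S and g :: "nat \<Rightarrow> int"
  proof -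
    have "(\<Sum>k\<in>S. exp (- \<epsilon> * real_of_int \<bar>k\<bar>)) = (\<Sum>k\<le>N. exp (- \<epsilon>) ^ k)"
      unfolding that(1) sum.reindex[OF that(2)]
      by (intro sum.cong refl) (simp add: that(3) exp_of_nat_mult[symmetric] mult.commute del:
        of_int_abs)
    also have "\<dots> \<le> (\<Sum>k. exp (- \<epsilon>) ^ k)"
      using q by (intro sum_le_suminf summable_geometric) auto
    also have "\<dots> = 1 / (1 - exp (- \<epsilon>))" using q by (intro suminf_geometric) auto
    finally show ?thesis .
  qed
  have "{- int N..int N} = int ` {..N} \<union> (\<lambda>k. - int k) ` {..N}"
  proof (intro equalityI subsetI)
    fix k assume "k \<in> {- int N..int N}"
    then have "k = int (nat \<bar>k\<bar>) \<or> k = - int (nat \<bar>k\<bar>)" "nat \<bar>k\<bar> \<le> N" by auto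
    then show "k \<in> int ` {..N} \<union> (\<lambda>k. - int k) ` {..N}" by blast
  qed auto
  then have "(\<Sum>k\<in>{- int N..int N}. exp (- \<epsilon> * real_of_int \<bar>k\<bar>))
    \<le> (\<Sum>k\<in>int ` {..N}. exp (- \<epsilon> * real_of_int \<bar>k\<bar>)) + (\<Sum>k\<in>(\<lambda>k. - int k) ` {..N}. exp (- \<epsilon> *
        real_of_int \<bar>k\<bar>))"
    using sum.union_inter[of "int ` {..N}" "(\<lambda>k. - int k) ` {..N}" "\<lambda>k. exp (- \<epsilon>
      * real_of_int \<bar>k\<bar>)"]
      sum_nonneg[of "int ` {..N} \<inter> (\<lambda>k. - int k) ` {..N}" "\<lambda>k. exp (- \<epsilon> * real_of_int \<bar>k\<bar>)"] by simp
  also have "\<dots> \<le> 1 / (1 - exp (- \<epsilon>)) + 1 / (1 - exp (- \<epsilon>))"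
    by (intro add_mono half[of _ int] half[of _ "\<lambda>k. - int k"]) (auto simp: inj_on_def)
  finally show ?thesis by simp
qed

text \<open>A finite set of lattice points lies in a cube. There the sum of products is a product of
  one-dimensional sums, each below a bound independent of the cube.\<close>

lemma l2_bounded_decay:
  assumes "\<epsilon> > 0"
  shows "\<exists>C. l2_bounded UNIV (\<lambda>m :: int ^ 'd. complex_of_real (decay \<epsilon> m)) C"
proof -
  define g where "g k = exp (- (2 * \<epsilon>) * real_of_int \<bar>k\<bar>)" for k
  \<comment> \<open>The bound of \<open>sum_decay_int\<close> at \<open>2 * \<epsilon>\<close>, as
    the envelope gets squared.\<close>
  define G where "G = 2 / (1 - exp (- (2 * \<epsilon>)))"
  have g: "0 \<le> g k" for k by (simp add: g_def)
  have sq: "(decay \<epsilon> m)\<^sup>2 = (\<Prod>r\<in>UNIV. g (m $ r))" for m :: "int ^ 'd"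
    unfolding decay_def g_def
    by (simp add: exp_sum[symmetric] exp_double[symmetric] sum_distrib_left mult.assoc sum_negf)
  have "(\<Sum>m\<in>F. (decay \<epsilon> m)\<^sup>2) \<le> G ^ CARD('d)" if F: "finite F" for F :: "(int ^ 'd) set"
  proof -
    \<comment> \<open>Inserting 0 covers the empty \<open>F\<close>.\<close>
    define N where "N = Max (insert 0 ((\<lambda>(m, r). nat \<bar>m $ r\<bar>) ` (F \<times> UNIV)))"
    have N: "\<bar>m $ r\<bar> \<le> int N" if "m \<in> F" for m r
    proof -
      have "nat \<bar>m $ r\<bar> \<le> N" unfolding N_def using F that by (intro Max_ge) force+
      then show ?thesis by simp
    qed
    have inj: "inj_on vec_nth F" by (auto simp: inj_on_def vec_nth_inject)
    have "(\<Sum>m\<in>F. (decay \<epsilon> m)\<^sup>2) = (\<Sum>f\<in>vec_nth ` F. \<Prod>r\<in>UNIV. g (f r))"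
      unfolding sq sum.reindex[OF inj] by simp
    also have "\<dots> \<le> (\<Sum>f\<in>PiE (UNIV :: 'd set) (\<lambda>_. {- int N..int N}). \<Prod>r\<in>UNIV. g (f r))"
    proof (rule sum_mono2)
      show "vec_nth ` F \<subseteq> PiE (UNIV :: 'd set) (\<lambda>_. {- int N..int N})"
      proof (intro subsetI PiE_I)
        fix f r assume "f \<in> vec_nth ` F"
        then obtain m where "m \<in> F" "f = vec_nth m" by blast
        then show "f r \<in> {- int N..int N}" using N[of m r] by (simp add: abs_le_iff)
      qed auto
    qed (auto intro!: finite_PiE prod_nonneg simp: g)
    also have "\<dots> = (\<Prod>r\<in>(UNIV :: 'd set). \<Sum>k\<in>{- int N..int N}. g k)"
      by (rule prod_sum_PiE[symmetric]) auto
    also have "\<dots> \<le> (\<Prod>r\<in>(UNIV :: 'd set). G)"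
      using sum_decay_int[of "2 * \<epsilon>" N] assms unfolding g_def[symmetric] G_def[symmetric]
      by (intro prod_mono) (auto intro: sum_nonneg g)
    finally show ?thesis by simp
  qed
  then have "l2_bounded UNIV (\<lambda>m :: int ^ 'd. complex_of_real (decay \<epsilon> m)) (sqrt (G ^ CARD('d)))"
    by (intro l2_boundedI) (auto simp: L2_set_def)
  then show ?thesis ..
qed

text \<open>The 1-norm changes by at most \<open>R\<close> under the shift, so the ratio of the two
  values lies between exp(- \<epsilon> R) and exp(\<epsilon> R). The error is relative to the value
  at \<open>m\<close>, so it carries over to norms.\<close>

lemma decay_shift:
  assumes "0 \<le> \<epsilon>" "(\<Sum>r\<in>UNIV. real_of_int \<bar>p $ r\<bar>) \<le> R"
  shows "\<bar>decay \<epsilon> (m + p) - decay \<epsilon> m\<bar> \<le> (exp (\<epsilon> * R) - 1) * decay \<epsilon> m"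
proof -
  define x where "x = (\<Sum>r\<in>UNIV. real_of_int \<bar>(m + p) $ r\<bar>) - (\<Sum>r\<in>UNIV. real_of_int \<bar>m $ r\<bar>)"
  have "\<bar>x\<bar> \<le> (\<Sum>r\<in>UNIV. real_of_int \<bar>p $ r\<bar>)"
    unfolding x_def sum_subtractf[symmetric]
      by (rule order_trans[OF sum_abs]) (intro sum_mono, auto)
  then have x: "\<bar>\<epsilon> * x\<bar> \<le> \<epsilon> * R" using assms by (auto simp: abs_mult intro!: mult_left_mono)
  have "decay \<epsilon> (m + p) = exp (- (\<epsilon> * x)) * decay \<epsilon> m"
    unfolding decay_def x_def exp_add[symmetric] by (simp add: algebra_simps)
  then have "decay \<epsilon> (m + p) - decay \<epsilon> m = (exp (- (\<epsilon> * x)) - 1) * decay \<epsilon> m"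
    by (simp add: algebra_simps)
  then have "\<bar>decay \<epsilon> (m + p) - decay \<epsilon> m\<bar> = \<bar>exp (- (\<epsilon> * x)) - 1\<bar> * decay \<epsilon> m"
    using decay_pos[of \<epsilon> m] by (simp add: abs_mult)
  moreover have "\<bar>exp (- (\<epsilon> * x)) - 1\<bar> \<le> exp (\<epsilon> * R) - 1"
  proof -
    have "exp (- (\<epsilon> * x)) \<le> exp (\<epsilon> * R)" using x by simp
    \<comment> \<open>Both sides are compared with \<epsilon> R: 1 - exp(- \<epsilon> R) \<le>
      \<epsilon> R \<le> exp(\<epsilon> R) - 1.\<close>
    moreover have "1 - exp (- (\<epsilon> * x)) \<le> exp (\<epsilon> * R) - 1"
    proof -
      have "1 - \<epsilon> * R \<le> exp (- (\<epsilon> * R))" using exp_ge_add_one_self[of "- (\<epsilon> * R)"] by simp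
      also have "\<dots> \<le> exp (- (\<epsilon> * x))" using x by simp
      finally show ?thesis using exp_ge_add_one_self[of "\<epsilon> * R"] by linarith
    qed
    ultimately show ?thesis by (simp add: abs_le_iff)
  qed
  ultimately show ?thesis using decay_pos[of \<epsilon> m] by (simp add: mult_right_mono)
qed

section \<open>Functions on lattice times cell, seen as a tensor product\<close>

abbreviation cells :: "nat \<Rightarrow> ('l \<times> nat) set" where
  "cells n \<equiv> UNIV \<times> {..<n}"

text \<open>The elementary tensor of \<open>w\<close> and \<open>g\<close>.\<close>

definition spread :: "nat \<Rightarrow> (nat \<Rightarrow> complex) \<Rightarrow> ('l \<Rightarrow> complex) \<Rightarrow> 'l \<times> nat \<Rightarrow> complex" where
  "spread n w g = (\<lambda>(m, j). if j < n then w j * g m else 0)"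

lemma l2_bounded_spread:
  assumes "l2_bounded UNIV g C"
  shows "l2_bounded (cells n) (spread n w g) ((\<Sum>j<n. cmod (w j)) * C)"
proof -
  have "l2_bounded (cells n) (\<lambda>v. if v \<in> UNIV \<times> {j} then w j * g (fst v) else 0) (cmod (w j) * C)"
      if "j < n" for j
    using that by (intro l2_bounded_reindex[OF l2_bounded_scale[OF assms], of fst]) (auto simp:
      inj_on_def)
  then have "l2_bounded (cells n) (\<lambda>v. \<Sum>j<n. if v \<in> UNIV \<times> {j} then w j
      * g (fst v) else 0) (\<Sum>j<n. cmod (w j) * C)"
    by (intro l2_bounded_sum) auto
  moreover have "(\<lambda>v. \<Sum>j<n. if v \<in> UNIV \<times> {j} then w j * g (fst v) else 0) = spread n w g"
    by (auto simp: fun_eq_iff spread_def)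
  ultimately show ?thesis by (simp add: sum_distrib_right)
qed

lemma l2_bounded_component:
  assumes "l2_bounded (cells n) f C" "j < n"
  shows "l2_bounded UNIV (\<lambda>m. f (m, j)) C"
  using l2_bounded_reindex[OF assms(1), of "\<lambda>m. (m, j)" UNIV UNIV] assms(2)
    by (auto simp: inj_on_def)

lemma l2_bounded_functional:
  assumes "l2_bounded (cells n) f C"
  shows "l2_bounded UNIV (\<lambda>m. \<Sum>l<n. w l * f (m, l)) ((\<Sum>l<n. cmod (w l)) * C)"
proof -
  have "l2_bounded UNIV (\<lambda>m. \<Sum>l<n. w l * f (m, l)) (\<Sum>l<n. cmod (w l) * C)"
    using assms by (intro l2_bounded_sum l2_bounded_scale l2_bounded_component) auto
  then show ?thesis by (simp add: sum_distrib_right)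
qed

text \<open>The matrix \<open>W\<close> tensored with the identity on the lattice.\<close>

definition fibre_apply :: "nat \<Rightarrow> (nat \<Rightarrow> nat \<Rightarrow> complex) \<Rightarrow> ('l \<times> nat \<Rightarrow> complex) \<Rightarrow> 'l \<times> nat \<Rightarrow> complex" where
  "fibre_apply n W f = (\<lambda>(m, j). if j < n then apply_mat n W (\<lambda>l. f (m, l)) j else 0)"

lemma l2_bounded_fibre_apply:
  assumes "l2_bounded (cells n) f C"
  shows "l2_bounded (cells n) (fibre_apply n W f) ((\<Sum>l<n. \<Sum>j<n. cmod (W j l)) * C)"
proof -
  have "l2_bounded (cells n) (\<lambda>v. \<Sum>l<n. spread n (\<lambda>j. W j l) (\<lambda>m. f (m, l)) v) (\<Sum>l<n. (\<Sum>j<n. cmod (W j l)) * C)"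
    using assms by (intro l2_bounded_sum l2_bounded_spread l2_bounded_component) auto
  moreover have "(\<lambda>v. \<Sum>l<n. spread n (\<lambda>j. W j l) (\<lambda>m. f (m, l)) v) = fibre_apply n W f"
    by (auto simp: fun_eq_iff spread_def fibre_apply_def apply_mat_def)
  ultimately show ?thesis by (simp add: sum_distrib_right)
qed

context quotient_graph
begin

text \<open>The Schroedinger operator in the coordinates (cell, vertex): an edge leads from cell
  \<open>m\<close> to cell \<open>m + \<tau> c\<close>. The identification is made in
  \<open>schroedinger_vert\<close>.\<close>

definition lattice_op :: "((int ^ 'd) \<times> nat \<Rightarrow> complex) \<Rightarrow> (int ^ 'd) \<times> nat \<Rightarrow> complex" where
  "lattice_op f = (\<lambda>(m, j). if j < n
     then of_real (D j) * f (m, j) - (\<Sum>c\<in>{c \<in> X. s c = j}. f (m + \<tau> c, t c)) else 0)"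

text \<open>
  A Bloch wave with an exponentially decaying envelope is an approximate eigenfunction. This envelope
  needs no boundary estimate: a shift changes it by a factor close to \<open>1\<close>.
\<close>

lemma band_subset_spectrum:
  assumes i: "i < n"
  shows "of_real (ev i \<theta>) \<in> ell2_spectrum (cells n) lattice_op"
proof (rule ccontr)
  assume "\<not> ?thesis"
  then obtain C where C: "\<And>f. f \<in> ell2 (cells n) \<Longrightarrow>
      ell2_norm (cells n) f \<le> C * ell2_norm (cells n) (\<lambda>v. lattice_op f v - of_real (ev i \<theta>) * f v)"
    by (auto simp: ell2_spectrum_iff l2_resolvent_def)
  obtain \<psi> j\<^sub>0 where j\<^sub>0: "j\<^sub>0 < n" "\<psi> j\<^sub>0 \<noteq> 0"
    and \<psi>: "\<And>j. j < n \<Longrightarrow> apply_mat n (floq \<theta>) \<psi> j = of_real (ev i \<theta>) * \<psi> j"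
    using eigs_eigenvector[OF hermitian_floq i] unfolding ev_def by blast
  \<comment> \<open>A common bound for the lengths of all jumps between cells; the summand 1 keeps
    it positive, since \<open>\<epsilon>\<close> is obtained by dividing by it.\<close>
  define R where "R = 1 + (\<Sum>c\<in>X. \<Sum>r\<in>UNIV. real_of_int \<bar>\<tau> c $ r\<bar>)"
  have R: "(\<Sum>r\<in>UNIV. real_of_int \<bar>\<tau> c $ r\<bar>) \<le> R" if "c \<in> X" for c
  proof -
    have "(\<Sum>r\<in>UNIV. real_of_int \<bar>\<tau> c $ r\<bar>) \<le> (\<Sum>c\<in>X. \<Sum>r\<in>UNIV. real_of_int \<bar>\<tau> c $ r\<bar>)"
      using finite_X that by (intro member_le_sum[of c X "\<lambda>c. \<Sum>r\<in>UNIV. real_of_int \<bar>\<tau> c $ r\<bar>"])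
        (auto intro!: sum_nonneg)
    then show ?thesis by (simp add: R_def)
  qed
  have "R > 0" unfolding R_def by (intro add_pos_nonneg sum_nonneg) auto
  define K where "K = (\<Sum>c\<in>X. cmod (\<psi> (t c)))"
  have "K \<ge> 0" by (simp add: K_def sum_nonneg)
  \<comment> \<open>\<open>M\<close> and \<open>\<delta>\<close> are set up so that the assumed
    resolvent bound \<open>C\<close> ends in \<open>cmod (\<psi> j\<^sub>0)\<close> being at most
    its own half; the summand 1 keeps \<open>M\<close> positive.\<close>
  define M where "M = 1 + \<bar>C\<bar> * real n * K"
  define \<delta> where "\<delta> = cmod (\<psi> j\<^sub>0) / (2 * M)"
  have den: "M > 0" unfolding M_def using \<open>K \<ge> 0\<close> by (intro add_pos_nonneg mult_nonneg_nonneg) auto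
  then have "\<delta> > 0" using j\<^sub>0 by (simp add: \<delta>_def)
  \<comment> \<open>Solves exp(\<epsilon> R) - 1 = \<delta>, so that \<delta> bounds the relative
    change of the envelope along an edge.\<close>
  define \<epsilon> where "\<epsilon> = ln (1 + \<delta>) / R"
  have \<epsilon>: "\<epsilon> > 0" "exp (\<epsilon> * R) - 1 = \<delta>" using \<open>\<delta> > 0\<close> \<open>R > 0\<close> by (auto simp: \<epsilon>_def)
  define \<phi> where "\<phi> m = complex_of_real (decay \<epsilon> m)" for m :: "int ^ 'd"
  obtain P0 where "l2_bounded UNIV \<phi> P0" using l2_bounded_decay[OF \<epsilon>(1)] unfolding \<phi>_def by blast
  then have \<phi>: "l2_bounded UNIV \<phi> (ell2_norm UNIV \<phi>)"
    using l2_bounded_imp_ell2 l2_bounded_ell2 by blast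
  \<comment> \<open>The norm of the envelope grows as \<open>\<epsilon>\<close> shrinks, but both
    estimates below are proportional to it, and it cancels.\<close>
  define P where "P = ell2_norm UNIV \<phi>"
  have "cmod (\<phi> 0) \<le> P" unfolding P_def by (rule l2_bounded_point[OF \<phi>])
  then have "P > 0" using decay_pos[of \<epsilon> "0 :: int ^ 'd"] by (simp add: \<phi>_def)
  define f where "f = (\<lambda>(m, j). if j < n then \<psi> j * (\<phi> m * exp (\<i> * of_real (pairing m \<theta>))) else 0)"
  have wave: "l2_bounded UNIV (\<lambda>m. \<phi> m * exp (\<i> * of_real (pairing m \<theta>))) P"
    using l2_bounded_dominated[OF \<phi>] by (auto simp: norm_mult P_def)
  have f: "f \<in> ell2 (cells n)"
    using l2_bounded_imp_ell2(1)[OF l2_bounded_spread[OF wave, of n \<psi>]]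
      by (simp add: f_def spread_def)
  \<comment> \<open>The plane wave has modulus one, so component \<open>j\<^sub>0\<close> alone
    already has the modulus of \<open>\<psi> j\<^sub>0\<close> times the envelope.\<close>
  have lower: "cmod (\<psi> j\<^sub>0) * P \<le> ell2_norm (cells n) f"
  proof -
    have "l2_bounded UNIV (\<lambda>m. \<psi> j\<^sub>0 * \<phi> m) (ell2_norm (cells n) f)"
      by (rule l2_bounded_dominated[OF l2_bounded_component[OF l2_bounded_ell2[OF f] j\<^sub>0(1)]])
        (auto simp: f_def j\<^sub>0 norm_mult)
    then have "l2_bounded UNIV (\<lambda>m. inverse (\<psi> j\<^sub>0) * (\<psi> j\<^sub>0 * \<phi> m)) (cmod (inverse (\<psi> j\<^sub>0))
        * ell2_norm (cells n) f)"
      by (rule l2_bounded_scale)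
    moreover have "(\<lambda>m. inverse (\<psi> j\<^sub>0) * (\<psi> j\<^sub>0 * \<phi> m)) = \<phi>"
      using j\<^sub>0 by (simp add: fun_eq_iff mult.assoc[symmetric])
    ultimately have "l2_bounded UNIV \<phi> (cmod (inverse (\<psi> j\<^sub>0)) * ell2_norm (cells n) f)" by simp
    then have "P \<le> cmod (inverse (\<psi> j\<^sub>0)) * ell2_norm (cells n) f"
      unfolding P_def by (rule l2_bounded_imp_ell2(2))
    then show ?thesis using j\<^sub>0 by (simp add: norm_inverse norm_divide divide_simps mult.commute)
  qed
  define h where "h v = lattice_op f v - of_real (ev i \<theta>) * f v" for v
  have h: "cmod (h (m, j)) \<le> K * \<delta> * decay \<epsilon> m" if j: "j < n" for m j
  proof -
    define E where "E m = exp (\<i> * complex_of_real (pairing m \<theta>))" for m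
    have E: "E (m + p) = E m * E p" for m p
      by (simp add: E_def pairing_def exp_add[symmetric] algebra_simps sum.distrib)
    \<comment> \<open>The eigenvalue equation turns the diagonal terms into a sum over edges, so
      that only differences of the envelope along edges survive.\<close>
    have "of_real (D j) * \<psi> j - of_real (ev i \<theta>) * \<psi> j = (\<Sum>c\<in>{c \<in> X. s c = j}. E (\<tau> c) * \<psi> (t c))"
      using \<psi>[OF j] unfolding apply_floq[OF j] E_def by (simp add: algebra_simps)
    then have "of_real (D j) * (\<psi> j * (\<phi> m * E m)) - of_real (ev i \<theta>) * (\<psi> j * (\<phi> m * E m))
      = (\<Sum>c\<in>{c \<in> X. s c = j}. E (\<tau> c) * \<psi> (t c)) * (\<phi> m * E m)"
      by (simp add: algebra_simps flip: left_diff_distrib)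
    then have "h (m, j) = (\<Sum>c\<in>{c \<in> X. s c = j}. E (\<tau> c) * \<psi> (t c) * (\<phi> m * E m) - \<psi> (t c) * (\<phi> (m
        + \<tau> c) * E (m + \<tau> c)))"
      using j t_less unfolding h_def lattice_op_def f_def E_def[symmetric] sum_subtractf
        sum_distrib_right
      by (simp add: algebra_simps)
    also have "\<dots> = (\<Sum>c\<in>{c \<in> X. s c = j}. \<psi> (t c) * E (m + \<tau> c) * (\<phi> m - \<phi> (m + \<tau> c)))"
      by (intro sum.cong refl) (simp add: E algebra_simps)
    finally have "cmod (h (m, j)) \<le> (\<Sum>c\<in>{c \<in> X. s c = j}. cmod (\<psi> (t c) * E (m + \<tau> c) * (\<phi> m
        - \<phi> (m + \<tau> c))))"
      using norm_sum by simp
    also have "\<dots> \<le> (\<Sum>c\<in>{c \<in> X. s c = j}. cmod (\<psi> (t c)) * (\<delta> * decay \<epsilon> m))"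
    proof (intro sum_mono)
      fix c assume c: "c \<in> {c \<in> X. s c = j}"
      have "cmod (\<phi> m - \<phi> (m + \<tau> c)) = \<bar>decay \<epsilon> (m + \<tau> c) - decay \<epsilon> m\<bar>"
        unfolding \<phi>_def of_real_diff[symmetric] norm_of_real by (rule abs_minus_commute)
      also have "\<dots> \<le> \<delta> * decay \<epsilon> m"
        using decay_shift[of \<epsilon> "\<tau> c" R m] R[of c] c \<epsilon> by simp
      finally show "cmod (\<psi> (t c) * E (m + \<tau> c) * (\<phi> m - \<phi> (m + \<tau> c))) \<le> cmod (\<psi> (t c)) * (\<delta>
          * decay \<epsilon> m)"
        by (simp add: norm_mult E_def mult_left_mono)
    qed
    also have "\<dots> \<le> (\<Sum>c\<in>X. cmod (\<psi> (t c)) * (\<delta> * decay \<epsilon> m))"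
      using finite_X \<open>\<delta> > 0\<close> decay_pos[of \<epsilon> m] by (intro sum_mono2) auto
    finally show ?thesis by (simp add: K_def sum_distrib_right mult.assoc)
  qed
  have h_bounded: "l2_bounded (cells n) h ((\<Sum>j<n. cmod (of_real (K * \<delta>))) * P)"
  proof (rule l2_bounded_dominated[OF l2_bounded_spread[OF \<phi>[folded P_def], of n "\<lambda>_. of_real (K
      * \<delta>)"]])
    fix v :: "(int ^ 'd) \<times> nat" assume "v \<in> cells n"
    then show "cmod (h v) \<le> cmod (spread n (\<lambda>_. of_real (K * \<delta>)) \<phi> v)"
      using h \<open>K \<ge> 0\<close> \<open>\<delta> > 0\<close> decay_pos[of \<epsilon> "fst v"]
      by (cases v) (auto simp: spread_def \<phi>_def norm_mult)
  qed (auto simp: h_def lattice_op_def f_def split: prod.splits)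
  then have upper: "ell2_norm (cells n) h \<le> real n * (K * \<delta>) * P"
    using l2_bounded_imp_ell2(2)[OF h_bounded] \<open>K \<ge> 0\<close> \<open>\<delta> > 0\<close> by (simp add: norm_mult)
  have "cmod (\<psi> j\<^sub>0) * P \<le> C * ell2_norm (cells n) h"
    using lower C[OF f] unfolding h_def by linarith
  also have "\<dots> \<le> \<bar>C\<bar> * (real n * (K * \<delta>) * P)"
  proof -
    have "h \<in> ell2 (cells n)" using l2_bounded_imp_ell2(1)[OF h_bounded] .
    then show ?thesis using upper ell2_norm_nonneg[of h "cells n"] by (intro mult_mono) auto
  qed
  also have "\<dots> = (\<bar>C\<bar> * real n * K) * \<delta> * P" by simp
  finally have "cmod (\<psi> j\<^sub>0) \<le> (\<bar>C\<bar> * real n * K) * \<delta>" using \<open>P > 0\<close> by simp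
  also have "\<dots> \<le> M * \<delta>" using \<open>\<delta> > 0\<close> by (simp add: M_def)
  also have "\<dots> = cmod (\<psi> j\<^sub>0) / 2" using den by (simp add: \<delta>_def)
  finally show False using j\<^sub>0 by simp
qed

end

section \<open>Off the bands: rank-one perturbation and Neumann series\<close>

lemma l2_bounded_shift_sum:
  fixes g :: "'l::ab_group_add \<Rightarrow> complex"
  assumes "finite B" "l2_bounded UNIV g C"
  shows "l2_bounded UNIV (\<lambda>m. \<Sum>c\<in>B. g (m + p c)) (real (card B) * C)"
proof -
  have "l2_bounded UNIV (\<lambda>m. g (m + p c)) C" for c
    using l2_bounded_reindex[OF assms(2), of "\<lambda>m. m + p c" UNIV UNIV] by (simp add: inj_on_def)
  from l2_bounded_sum[OF assms(1) this] show ?thesis by simp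
qed

text \<open>The sum of the shifts has norm at most \<open>card B\<close>, so the powers of
  \<open>\<mu>\<close> times this sum, applied to \<open>h\<close>, are dominated by a geometric
  series. The series is summed pointwise, and the norm bound passes to the limit.\<close>

lemma neumann_series:
  fixes h :: "'l::ab_group_add \<Rightarrow> complex"
  assumes B: "finite B" and h: "l2_bounded UNIV h C" and \<mu>: "cmod \<mu> * real (card B) < 1"
  shows "\<exists>g C'. l2_bounded UNIV g C' \<and> (\<forall>m. g m = h m + \<mu> * (\<Sum>c\<in>B. g (m + p c)))"
proof -
  define \<beta> where "\<beta> = real (card B)"
  define a where "a q = ((\<lambda>g m. \<Sum>c\<in>B. g (m + p c)) ^^ q) h" for q
  have a_Suc: "a (Suc q) m = (\<Sum>c\<in>B. a q (m + p c))" and a_0: "a 0 = h" for q m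
    by (simp_all add: a_def)
  have a: "l2_bounded UNIV (a q) (\<beta> ^ q * C)" for q
  proof (induction q)
    case (Suc q)
    from l2_bounded_shift_sum[OF B this, of p] show ?case
      unfolding \<beta>_def[symmetric] by (simp add: a_Suc[symmetric] mult.assoc)
  qed (simp add: a_0 h)
  define r where "r = cmod \<mu> * \<beta>"
  have r: "0 \<le> r" "r < 1" using \<mu> by (simp_all add: r_def \<beta>_def)
  have C: "0 \<le> C" by (rule l2_bounded_nonneg[OF h])
  have trm: "l2_bounded UNIV (\<lambda>m. \<mu> ^ q * a q m) (r ^ q * C)" for q
    using l2_bounded_scale[OF a, of "\<mu> ^ q" q]
      by (simp add: r_def norm_power power_mult_distrib mult.assoc)
  have summable: "summable (\<lambda>q. \<mu> ^ q * a q m)" for m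
  proof (rule summable_comparison_test')
    show "summable (\<lambda>q. r ^ q * C)" using r by (intro summable_mult2 summable_geometric) simp
    show "norm (\<mu> ^ q * a q m) \<le> r ^ q * C" if "q \<ge> 0" for q
      by (rule l2_bounded_point[OF trm])
  qed
  define g where "g m = (\<Sum>q. \<mu> ^ q * a q m)" for m
  have "l2_bounded UNIV g (1 / (1 - r) * C)"
  proof (rule l2_bounded_limit)
    fix N
    have "l2_bounded UNIV (\<lambda>m. \<Sum>q<N. \<mu> ^ q * a q m) (\<Sum>q<N. r ^ q * C)"
      using trm by (intro l2_bounded_sum) auto
    moreover have "(\<Sum>q<N. r ^ q * C) \<le> 1 / (1 - r) * C"
    proof -
      have "(\<Sum>q<N. r ^ q) \<le> (\<Sum>q. r ^ q)" using r by (intro sum_le_suminf summable_geometric) auto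
      also have "\<dots> = 1 / (1 - r)" using r by (intro suminf_geometric) simp
      finally show ?thesis unfolding sum_distrib_right[symmetric] using C by (rule mult_right_mono)
    qed
    ultimately show "l2_bounded UNIV (\<lambda>m. \<Sum>q<N. \<mu> ^ q * a q m) (1 / (1 - r) * C)"
      by (rule l2_bounded_mono)
    show "(\<lambda>N. \<Sum>q<N. \<mu> ^ q * a q m) \<longlonglongrightarrow> g m" for m
      unfolding g_def by (rule summable_LIMSEQ[OF summable])
  qed simp
  moreover have "g m = h m + \<mu> * (\<Sum>c\<in>B. g (m + p c))" for m
  proof -
    have "g m = h m + (\<Sum>q. \<mu> ^ Suc q * a (Suc q) m)"
      unfolding g_def using suminf_split_head[OF summable, of m] by (simp add: a_0)
    also have "(\<Sum>q. \<mu> ^ Suc q * a (Suc q) m) = (\<Sum>q. \<mu> * (\<Sum>c\<in>B. \<mu> ^ q * a q (m + p c)))"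
      by (simp add: a_Suc sum_distrib_left mult.assoc)
    also have "\<dots> = \<mu> * (\<Sum>q. \<Sum>c\<in>B. \<mu> ^ q * a q (m + p c))"
      using summable by (intro suminf_mult summable_sum)
    also have "(\<Sum>q. \<Sum>c\<in>B. \<mu> ^ q * a q (m + p c)) = (\<Sum>c\<in>B. g (m + p c))"
      unfolding g_def using summable by (intro suminf_sum)
    finally show ?thesis .
  qed
  ultimately show ?thesis by blast
qed

context quotient_graph
begin

definition perturbed :: "nat \<Rightarrow> real \<Rightarrow> nat \<Rightarrow> nat \<Rightarrow> complex" where
  "perturbed k r j l = floq 0 j l + (if j = k \<and> l = k then of_real r else 0)"

lemma hermitian_perturbed: "hermitian_n n (perturbed k r)"
  unfolding hermitian_n_def perturbed_def by (simp add: hermitian_nD[OF hermitian_floq])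

lemma apply_perturbed:
  assumes "k < n"
  shows "apply_mat n (perturbed k r) x j = apply_mat n (floq 0) x j + (if j = k then of_real r
      * x k else 0)"
proof -
  have "(\<Sum>l<n. (if j = k \<and> l = k then complex_of_real r else 0) * x l) = (\<Sum>l<n. if l
      = k then (if j = k then of_real r * x k else 0) else 0)"
    by (intro sum.cong) auto
  also have "\<dots> = (if j = k then of_real r * x k else 0)" using assms by simp
  finally show ?thesis by (simp add: apply_mat_def perturbed_def distrib_right sum.distrib)
qed

lemma quad_form_perturbed:
  assumes "k < n"
  shows "quad_form n (perturbed k r) x = quad_form n (floq 0) x + r * (cmod (x k))\<^sup>2"
proof -
  have "inner_n n x (apply_mat n (perturbed k r) x)
    = inner_n n x (apply_mat n (floq 0) x) + (\<Sum>j<n.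
        if j = k then cnj (x k) * (of_real r * x k) else 0)"
    unfolding inner_n_def sum.distrib[symmetric]
    by (intro sum.cong) (auto simp: apply_perturbed[OF assms] algebra_simps)
  also have "(\<Sum>j<n. if j = k then cnj (x k) * (of_real r * x k) else 0) = of_real (r
      * (cmod (x k))\<^sup>2)"
    using assms by (simp add: complex_norm_square mult.commute mult.left_commute del: of_real_power)
  finally show ?thesis by (simp add: quad_form_def)
qed

text \<open>The form lies between those of \<open>floq 0\<close> and
  \<open>floq \<theta>\<^sub>0\<close>, the latter having the form with
  \<open>r = 2 * real (card Br)\<close>; by min-max the eigenvalues are squeezed likewise. This
  avoids solving for a quasimomentum that realises \<open>r\<close>.\<close>

lemma eigs_perturbed_in_band:
  assumes precise: "\<And>c. c \<in> Br \<Longrightarrow> cos (pairing (\<tau> c) \<theta>\<^sub>0) = -1"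
    and k: "\<And>c. c \<in> Br \<Longrightarrow> s c = k" "k < n"
    and r: "0 \<le> r" "r \<le> 2 * real (card Br)" and "i < n"
  shows "eigs n (perturbed k r) ! i \<in> range (ev i)"
proof -
  have "eigs n (floq 0) ! i \<le> eigs n (perturbed k r) ! (i + 0) + 0"
    using assms by (intro eigs_le hermitian_floq hermitian_perturbed) (auto simp:
      quad_form_perturbed)
  moreover have "eigs n (perturbed k r) ! i \<le> eigs n (floq \<theta>\<^sub>0) ! (i + 0) + 0"
  proof (intro eigs_le hermitian_floq hermitian_perturbed)
    fix x :: "nat \<Rightarrow> complex"
    have "(\<Sum>c\<in>Br. (cos (pairing (\<tau> c) 0) - cos (pairing (\<tau> c) \<theta>\<^sub>0)) * (cmod (x (s c)))\<^sup>2)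
      = (\<Sum>c\<in>Br. 2 * (cmod (x k))\<^sup>2)"
      using precise k by (intro sum.cong refl) (simp add: pairing_zero)
    then have "quad_form n (floq \<theta>\<^sub>0) x = quad_form n (floq 0) x + 2 * real (card Br)
        * (cmod (x k))\<^sup>2"
      unfolding quad_form_diff[of \<theta>\<^sub>0 x 0] by simp
    then show "quad_form n (perturbed k r) x \<le> quad_form n (floq \<theta>\<^sub>0) x + 0
        * (\<Sum>i<n. (cmod (x i))\<^sup>2)"
      unfolding quad_form_perturbed[OF k(2)] using r by (simp add: mult_right_mono)
  qed (use assms in auto)
  ultimately show ?thesis
    using band_eq[OF \<open>i < n\<close> precise] by (simp add: ev_def)
qed

text \<open>Edges of index zero stay within the cell. The parameter \<open>real (card Br)\<close>
  cancels the contribution of the bridges to \<open>floq 0\<close>, so that they appear only as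
  shifts.\<close>

lemma lattice_op_perturbed:
  assumes k: "\<And>c. c \<in> Br \<Longrightarrow> s c = k" "k < n" and "j < n"
  shows "lattice_op f (m, j) = apply_mat n (perturbed k (real (card Br))) (\<lambda>l. f (m, l)) j
    - (if j = k then \<Sum>c\<in>Br. f (m + \<tau> c, k) else 0)"
proof -
  have "(\<Sum>c\<in>{c \<in> X. s c = j}. f (m, t c)) - (\<Sum>c\<in>{c \<in> X. s c = j}. f (m + \<tau> c, t c))
    = (\<Sum>c\<in>{c \<in> X. s c = j}. f (m, t c) - f (m + \<tau> c, t c))" by (rule sum_subtractf[symmetric])
  also have "\<dots> = (\<Sum>c\<in>Br. if j = k then f (m, k) - f (m + \<tau> c, k) else 0)"
  proof (intro sum.mono_neutral_cong)
    show "f (m, t c) - f (m + \<tau> c, t c) = 0" if "c \<in> {c \<in> X. s c = j} - Br" for c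
      using that by (auto simp: Br_def)
    show "(if j = k then f (m, k) - f (m + \<tau> c, k) else 0) = 0" if "c \<in> Br - {c \<in> X. s c = j}" for c
      using that k Br_subset by auto
    show "f (m, t c) - f (m + \<tau> c, t c) = (if j = k then f (m, k) - f (m + \<tau> c, k) else 0)"
      if c: "c \<in> {c \<in> X. s c = j} \<inter> Br" for c
    proof -
      have "s c = t c" using c loops by (auto simp: Br_def)
      then show ?thesis using c k by auto
    qed
  qed (auto simp: finite_X finite_Br)
  also have "\<dots> = (if j = k then of_nat (card Br) * f (m, k) - (\<Sum>c\<in>Br. f (m + \<tau> c, k)) else 0)"
    by (simp add: sum_subtractf)
  finally show ?thesis
    using assms(3) by (simp add: lattice_op_def apply_perturbed[OF k(2)] apply_floq pairing_zero
      algebra_simps)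
qed

text \<open>
  With all bridges at \<open>k\<close> the operator is a fixed Hermitian matrix in every cell, minus the sum of
  \<open>\<beta>\<close> shifts acting on the component \<open>k\<close>. Off the bands all the matrices perturbed by
  \<open>r \<in> {0..2\<beta>}\<close> are invertible, which says that the diagonal entry \<open>\<mu>\<close> of the resolvent of the middle
  one satisfies \<open>\<bar>\<mu>\<bar> \<beta> < 1\<close>; so the shifts can be treated by a Neumann series.
\<close>

lemma spectrum_subset_bands:
  assumes precise: "\<And>c. c \<in> Br \<Longrightarrow> cos (pairing (\<tau> c) \<theta>\<^sub>0) = -1"
    and k: "\<And>c. c \<in> Br \<Longrightarrow> s c = k" "k < n"
    and x: "x \<notin> (\<Union>i<n. range (ev i))"
  shows "of_real x \<notin> ell2_spectrum (cells n) lattice_op"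
proof -
  define \<beta> where "\<beta> = real (card Br)"
  define A where "A = perturbed k \<beta>"
  have \<beta>: "0 \<le> \<beta>" by (simp add: \<beta>_def)
  have regular: "\<forall>l<n. eigs n (perturbed k r) ! l \<noteq> x" if "0 \<le> r" "r \<le> 2 * \<beta>" for r
    using eigs_perturbed_in_band[OF precise k that[unfolded \<beta>_def]] x by blast
  obtain W where hermW: "hermitian_n n W"
    and WA: "\<And>y i. i < n \<Longrightarrow> apply_mat n W (\<lambda>j. apply_mat n A y j - of_real x * y j) i = y i"
    and AW: "\<And>y i. i < n \<Longrightarrow> apply_mat n A (apply_mat n W y) i - of_real x * apply_mat n W y i = y i"
    using hermitian_resolvent[of n "perturbed k \<beta>" x, OF hermitian_perturbed regular] \<beta>
      unfolding A_def by auto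
  define \<mu> where "\<mu> = W k k"
  define e where "e c j = (if j = k then c else (0 :: complex))" for c j
  have We: "apply_mat n W (\<lambda>j. y j + e c j) i = apply_mat n W y i + W i k * c" for y c i
  proof -
    have "(\<Sum>j<n. W i j * e c j) = (\<Sum>j<n. if j = k then W i k * c else 0)"
      by (intro sum.cong) (auto simp: e_def)
    then show ?thesis using k(2) by (simp add: apply_mat_def distrib_left sum.distrib)
  qed
  obtain b where \<mu>_real: "\<mu> = of_real b"
    using hermitian_nD[OF hermW k(2) k(2)] unfolding \<mu>_def by (metis Reals_cnj_iff Reals_cases)
  have \<mu>: "cmod \<mu> * \<beta> < 1"
  proof (rule ccontr)
    assume "\<not> ?thesis"
    then have ge: "1 \<le> \<bar>b\<bar> * \<beta>" using \<mu>_real by simp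
    then have nz: "b \<noteq> 0" by auto
    \<comment> \<open>Column \<open>k\<close> of \<open>W\<close> is mapped by \<open>A\<close>
      minus \<open>x\<close> to the \<open>k\<close>-th unit vector, and its entry \<open>k\<close>
      is \<open>b\<close>. Subtracting 1/b times the projection to coordinate \<open>k\<close> from
      \<open>A\<close> thus makes it an eigenvector for \<open>x\<close>, while
      \<open>\<bar>1 / b\<bar> \<le> \<beta>\<close> keeps the parameter in [0, 2 \<beta>].\<close>
    define r where "r = \<beta> - 1 / b"
    have inv: "\<bar>1 / b\<bar> \<le> \<beta>" using ge nz by (simp add: field_simps)
    have r: "0 \<le> r" "r \<le> 2 * \<beta>"
      using abs_le_D1[OF inv] abs_le_D2[OF inv] by (simp_all add: r_def)
    define w where "w i = W i k" for i
    have w: "w i = apply_mat n W (e 1) i" for i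
      using We[of "\<lambda>_. 0" 1 i] by (simp add: w_def apply_mat_def)
    have "apply_mat n (perturbed k r) w i = of_real x * w i" if "i < n" for i
    proof -
      have "apply_mat n A w i = of_real x * w i + e 1 i"
        using AW[OF that, of "e 1"] unfolding w[abs_def, symmetric] by (simp add: algebra_simps)
      moreover have "apply_mat n (perturbed k r) w i = apply_mat n A w i - e (w k / \<mu>) i"
        unfolding A_def apply_perturbed[OF k(2)] e_def r_def using \<mu>_real
        by (simp add: left_diff_distrib)
      moreover have "w k / \<mu> = 1" using nz \<mu>_real by (auto simp: w_def \<mu>_def)
      ultimately show ?thesis by simp
    qed
    moreover have "w k \<noteq> 0" using nz \<mu>_real by (auto simp: w_def \<mu>_def)
    ultimately have "\<exists>l<n. eigs n (perturbed k r) ! l = x"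
      using k(2) by (intro eigenvector_in_eigs[OF hermitian_perturbed, where x = w]) auto
    with regular[OF r] show False by blast
  qed
  define hop where "hop g m = (\<Sum>c\<in>Br. g (m + \<tau> c))" for g :: "int ^ 'd \<Rightarrow> complex" and m
  have hop: "l2_bounded UNIV (hop g) (\<beta> * C)" if "l2_bounded UNIV g C" for g C
    using l2_bounded_shift_sum[OF finite_Br that] unfolding hop_def[abs_def] \<beta>_def .
  define R where "R f v = lattice_op f v - of_real x * f v" for f :: "(int ^ 'd) \<times> nat \<Rightarrow> complex"
      and v
  have R: "R f (m, j) = apply_mat n A (\<lambda>l. f (m, l)) j - of_real x * f (m, j)
      - e (hop (\<lambda>m. f (m, k)) m) j"
    if "j < n" for f m j
    using lattice_op_perturbed[OF k that, of f m] by (simp add: R_def A_def \<beta>_def e_def hop_def)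
  have R_off: "R f v = 0" if "v \<notin> cells n" "f v = 0" for f v
    using that by (auto simp: R_def lattice_op_def split: prod.splits)
  \<comment> \<open>Applying \<open>W\<close> in every cell reduces the equation for
    \<open>f\<close> to a scalar equation on the lattice for component \<open>k\<close>; given that
    component, the others are explicit.\<close>
  have solve: "f (m, j) = apply_mat n W (\<lambda>l. R f (m, l)) j + W j k * hop (\<lambda>m. f (m, k)) m"
      if "j < n" for f m j
  proof -
    have "f (m, j) = apply_mat n W (\<lambda>j. apply_mat n A (\<lambda>l. f (m, l)) j - of_real x * f (m, j)) j"
      using WA[OF that, of "\<lambda>l. f (m, l)"] by simp
    also have "\<dots> = apply_mat n W (\<lambda>j. R f (m, j) + e (hop (\<lambda>m. f (m, k)) m) j) j"
      unfolding apply_mat_def[of n W] by (intro sum.cong) (auto simp: R)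
    finally show ?thesis unfolding We .
  qed
  define C1 where "C1 = (\<Sum>l<n. cmod (W k l))"
  define C2 where "C2 = (\<Sum>l<n. \<Sum>j<n. cmod (W j l))"
  define C3 where "C3 = (\<Sum>j<n. cmod (W j k))"
  \<comment> \<open>\<open>C2\<close> bounds the cellwise resolvent; the other summand bounds its
    correction by the bridges, where the denominator stems from the scalar equation for component
    \<open>k\<close>.\<close>
  define C where "C = C2 + C3 * \<beta> * (C1 / (1 - cmod \<mu> * \<beta>))"
  have R_in: "R f \<in> ell2 (cells n)" if f: "f \<in> ell2 (cells n)" for f
  proof -
    note fb = l2_bounded_ell2[OF f]
    note b = l2_bounded_add[OF l2_bounded_add[OF l2_bounded_fibre_apply[OF fb, of A]
        l2_bounded_scale[OF fb, of "- of_real x"]]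
        l2_bounded_spread[OF hop[OF l2_bounded_component[OF fb k(2)]], of n "\<lambda>j. e (-1) j"]]
    have "(\<lambda>v. fibre_apply n A f v + - of_real x * f v + spread n (e (-1)) (hop (\<lambda>m. f (m, k))) v)
        = R f"
    proof
      fix v :: "(int ^ 'd) \<times> nat"
      obtain m j where v: "v = (m, j)" by (cases v)
      show "fibre_apply n A f v + - of_real x * f v + spread n (e (-1)) (hop (\<lambda>m. f (m, k))) v
          = R f v"
      proof (cases "j < n")
        case True
        then show ?thesis unfolding v by (simp add: R fibre_apply_def spread_def e_def)
      next
        case False
        then have "f v = 0" "v \<notin> cells n" using l2_boundedD(1)[OF fb] v by auto
        then show ?thesis using R_off False v by (simp add: fibre_apply_def spread_def)
      qed
    qed
    with b show ?thesis using l2_bounded_imp_ell2(1) by fastforce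
  qed
  have lower: "ell2_norm (cells n) f \<le> C * ell2_norm (cells n) (R f)"
      if f: "f \<in> ell2 (cells n)" for f
  proof -
    define H where "H = ell2_norm (cells n) (R f)"
    have Rf: "l2_bounded (cells n) (R f) H" unfolding H_def by (rule l2_bounded_ell2[OF R_in[OF f]])
    define g where "g m = f (m, k)" for m
    have "l2_bounded UNIV g (ell2_norm (cells n) f)"
      unfolding g_def by (rule l2_bounded_component[OF l2_bounded_ell2[OF f] k(2)])
    then have g_in: "g \<in> ell2 UNIV" by (rule l2_bounded_imp_ell2)
    define G where "G = ell2_norm UNIV g"
    have g: "l2_bounded UNIV g G" unfolding G_def by (rule l2_bounded_ell2[OF g_in])
    have g_eq: "g m = (\<Sum>l<n. W k l * R f (m, l)) + \<mu> * hop g m" for m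
      using solve[OF k(2), of f m] unfolding g_def[abs_def] apply_mat_def \<mu>_def .
    have "l2_bounded UNIV (\<lambda>m. (\<Sum>l<n. W k l * R f (m, l)) + \<mu> * hop g m) (C1 * H + cmod \<mu> * (\<beta>
        * G))"
      unfolding C1_def by (intro l2_bounded_add l2_bounded_functional[OF Rf] l2_bounded_scale
        hop[OF g])
    moreover have "(\<lambda>m. (\<Sum>l<n. W k l * R f (m, l)) + \<mu> * hop g m) = g"
      by (rule ext) (rule g_eq[symmetric])
    ultimately have "l2_bounded UNIV g (C1 * H + cmod \<mu> * (\<beta> * G))" by (simp only:)
    then have "G \<le> C1 * H + cmod \<mu> * (\<beta> * G)" unfolding G_def by (rule l2_bounded_imp_ell2)
    \<comment> \<open>\<open>G\<close> is a finite norm, so its multiple on the right can be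
      absorbed.\<close>
    then have "G * (1 - cmod \<mu> * \<beta>) \<le> C1 * H" by (simp add: algebra_simps)
    then have G: "G \<le> C1 * H / (1 - cmod \<mu> * \<beta>)" using \<mu> by (subst pos_le_divide_eq) auto
    have "l2_bounded (cells n) (\<lambda>v. fibre_apply n W (R f) v + spread n (\<lambda>j. W j k) (hop g) v) (C2
        * H + C3 * (\<beta> * G))"
      unfolding C2_def C3_def by (intro l2_bounded_add l2_bounded_fibre_apply[OF Rf]
        l2_bounded_spread hop[OF g])
    moreover have "(\<lambda>v. fibre_apply n W (R f) v + spread n (\<lambda>j. W j k) (hop g) v) = f"
    proof
      fix v :: "(int ^ 'd) \<times> nat"
      obtain m j where v: "v = (m, j)" by (cases v)
      show "fibre_apply n W (R f) v + spread n (\<lambda>j. W j k) (hop g) v = f v"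
        using solve[of j f m] l2_boundedD(1)[OF l2_bounded_ell2[OF f], of v]
        unfolding v fibre_apply_def spread_def g_def[abs_def] by auto
    qed
    ultimately have "l2_bounded (cells n) f (C2 * H + C3 * (\<beta> * G))" by simp
    then have "ell2_norm (cells n) f \<le> C2 * H + C3 * (\<beta> * G)" by (rule l2_bounded_imp_ell2)
    also have "\<dots> \<le> C2 * H + C3 * (\<beta> * (C1 * H / (1 - cmod \<mu> * \<beta>)))"
      using G \<beta> unfolding C3_def by (intro add_left_mono mult_left_mono sum_nonneg) auto
    also have "\<dots> = C * H" by (simp add: C_def algebra_simps)
    finally show ?thesis unfolding H_def .
  qed
  have inj: "inj_on R (ell2 (cells n))"
  proof (rule inj_onI)
    fix f f' assume f: "f \<in> ell2 (cells n)" "f' \<in> ell2 (cells n)" and eq: "R f = R f'"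
    define d where "d v = f v + (-1) * f' v" for v
    have "l2_bounded (cells n) d (ell2_norm (cells n) f + cmod (-1) * ell2_norm (cells n) f')"
      unfolding d_def using f by (intro l2_bounded_add l2_bounded_scale l2_bounded_ell2)
    then have d: "d \<in> ell2 (cells n)" by (rule l2_bounded_imp_ell2)
    have "R d v = R f v - R f' v" for v
      by (cases v) (simp add: R_def d_def lattice_op_def sum_subtractf algebra_simps)
    then have "R d = (\<lambda>_. 0)" using eq by (simp add: fun_eq_iff)
    then have "ell2_norm (cells n) d \<le> 0" using lower[OF d] by (simp add: ell2_norm_def)
    then have "cmod (d v) \<le> 0" for v using l2_bounded_point[OF l2_bounded_ell2[OF d], of v]
        by linarith
    then show "f = f'" by (simp add: d_def fun_eq_iff)
  qed
  have surj: "\<exists>f\<in>ell2 (cells n). R f = h" if h: "h \<in> ell2 (cells n)" for h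
  proof -
    note hb = l2_bounded_ell2[OF h]
    obtain g G where g: "l2_bounded UNIV g G"
        and g_eq: "\<And>m. g m = (\<Sum>l<n. W k l * h (m, l)) + \<mu> * hop g m"
      using neumann_series[OF finite_Br l2_bounded_functional[OF hb, of "W k"], of \<mu> \<tau>] \<mu>
      unfolding hop_def \<beta>_def by blast
    \<comment> \<open>The formula of \<open>solve\<close>, read as a definition. That component
      \<open>k\<close> of this \<open>f\<close> is again \<open>g\<close> is exactly the scalar
      equation solved by the Neumann series.\<close>
    define f where "f v = fibre_apply n W h v + spread n (\<lambda>j. W j k) (hop g) v" for v
    have fb: "l2_bounded (cells n) f (C2 * ell2_norm (cells n) h + C3 * (\<beta> * G))"
      unfolding C2_def C3_def f_def
      by (intro l2_bounded_add l2_bounded_fibre_apply[OF hb] l2_bounded_spread hop[OF g])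
    have f: "f (m, j) = apply_mat n W (\<lambda>l. h (m, l) + e (hop g m) l) j" if "j < n" for m j
      using that by (simp add: We f_def fibre_apply_def spread_def)
    have fk: "(\<lambda>m. f (m, k)) = g"
    proof
      fix m show "f (m, k) = g m"
        unfolding f[OF k(2)] We g_eq[of m] by (simp add: apply_mat_def \<mu>_def)
    qed
    have "R f v = h v" for v
    proof -
      obtain m j where v: "v = (m, j)" by (cases v)
      show ?thesis
      proof (cases "j < n")
        case True
        let ?y = "\<lambda>l. h (m, l) + e (hop g m) l"
        have "apply_mat n A (\<lambda>l. f (m, l)) j = apply_mat n A (apply_mat n W ?y) j"
          unfolding apply_mat_def[of n A] by (intro sum.cong) (auto simp: f)
        then have "apply_mat n A (\<lambda>l. f (m, l)) j - of_real x * f (m, j) = ?y j"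
          using AW[OF True, of ?y] f[OF True] by simp
        then show ?thesis unfolding v R[OF True] fk by simp
      next
        case False
        then show ?thesis
          using R_off[of v f] l2_boundedD(1)[OF fb, of v] l2_boundedD(1)[OF hb, of v] v by auto
      qed
    qed
    then show ?thesis using l2_bounded_imp_ell2(1)[OF fb] by blast
  qed
  have "bij_betw R (ell2 (cells n)) (ell2 (cells n))"
    unfolding bij_betw_def using inj R_in surj by blast
  then show ?thesis
    unfolding ell2_spectrum_iff l2_resolvent_def R_def[abs_def, symmetric] using lower by blast
qed

end

section \<open>The fundamental graph\<close>

lemma lattice_vec_add: "lattice_vec a (m + p) = lattice_vec a m + lattice_vec a p"
  by (simp add: lattice_vec_def scaleR_left_distrib sum.distrib)

lemma lattice_vec_zero [simp]: "lattice_vec a 0 = 0"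
  by (simp add: lattice_vec_def)

lemma lattice_vec_minus: "lattice_vec a (- m) = - lattice_vec a m"
  by (simp add: lattice_vec_def sum_negf)

lemma lattice_vec_diff: "lattice_vec a (m - p) = lattice_vec a m - lattice_vec a p"
  using lattice_vec_add[of a m "- p"] by (simp add: lattice_vec_minus)

lemma osrc_otranslate [simp]: "osrc (otranslate u x) = osrc x + u"
  and otgt_otranslate [simp]: "otgt (otranslate u x) = otgt x + u"
  by (cases x; simp)+

lemma otranslate_otranslate: "otranslate u (otranslate u' x) = otranslate (u' + u) x"
  by (cases x) (simp add: image_image add.assoc)

lemma otranslate_zero [simp]: "otranslate 0 x = x"
  by (cases x) simp

lemma oorbit_refl: "x \<in> oorbit a x"
  unfolding oorbit_def by (rule range_eqI[of _ _ 0]) simp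

lemma oorbit_otranslate: "oorbit a (otranslate (lattice_vec a m) x) = oorbit a x"
proof (intro equalityI subsetI)
  fix y assume "y \<in> oorbit a (otranslate (lattice_vec a m) x)"
  then obtain p where "y = otranslate (lattice_vec a p) (otranslate (lattice_vec a m) x)"
    by (auto simp: oorbit_def)
  then have "y = otranslate (lattice_vec a (m + p)) x"
    by (simp add: otranslate_otranslate lattice_vec_add)
  then show "y \<in> oorbit a x" by (auto simp: oorbit_def)
next
  fix y assume "y \<in> oorbit a x"
  then obtain p where "y = otranslate (lattice_vec a p) x" by (auto simp: oorbit_def)
  then have "y = otranslate (lattice_vec a (p - m)) (otranslate (lattice_vec a m) x)"
    by (simp add: otranslate_otranslate lattice_vec_diff)
  then show "y \<in> oorbit a (otranslate (lattice_vec a m) x)" by (auto simp: oorbit_def)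
qed

text \<open>The flag is kept, so both orientations of a loop of the periodic graph are fixed. This
  agrees with \<open>quotient_graph\<close>, as such a loop has index zero and equal end points. An
  edge that becomes a loop only in the quotient has distinct end points and is genuinely
  reversed.\<close>

fun orev :: "'d oedge \<Rightarrow> 'd oedge" where
  "orev (e, u, w, b) = (e, w, u, b)"

lemma orev_orev [simp]: "orev (orev x) = x"
  by (cases x) simp

lemma osrc_orev [simp]: "osrc (orev x) = otgt x"
  and otgt_orev [simp]: "otgt (orev x) = osrc x"
  by (cases x; simp)+

lemma orev_otranslate: "orev (otranslate u x) = otranslate u (orev x)"
  by (cases x) simp

lemma orev_oorbit: "orev ` oorbit a x = oorbit a (orev x)"
  by (simp add: oorbit_def image_image orev_otranslate)

locale periodic_graph_origin =
  fixes V :: "(real ^ 'd) set" and E :: "(real ^ 'd) set set" and a :: "'d \<Rightarrow> real ^ 'd"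
    and orig :: "real ^ 'd"
  assumes periodic: "periodic_graph V E a"
begin

abbreviation lat :: "int ^ 'd \<Rightarrow> real ^ 'd" where "lat \<equiv> lattice_vec a"

lemma basis: "inj a" "independent (range a)" "span (range a) = UNIV"
  using periodic by (auto simp: periodic_graph_def is_periods_def)

text \<open>The translations that preserve \<open>V\<close> and \<open>E\<close> form a group; it
  contains the periods, hence their integer multiples and the sums of these.\<close>

lemma translate_lat: "(\<lambda>x. x + lat m) ` V = V" "(\<lambda>e. (\<lambda>x. x + lat m) ` e) ` E = E"
proof -
  define P where "P u \<longleftrightarrow> (\<lambda>x. x + u) ` V = V \<and> (\<lambda>e. (\<lambda>x. x + u) ` e) ` E = E" for u :: "real ^ 'd"
  have P_add: "P (u + u')" if "P u" "P u'" for u u'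
  proof -
    have "(\<lambda>x. x + (u + u')) ` V = (\<lambda>x. x + u') ` (\<lambda>x. x + u) ` V"
      "(\<lambda>e. (\<lambda>x. x + (u + u')) ` e) ` E = (\<lambda>e. (\<lambda>x. x + u') ` e) ` (\<lambda>e. (\<lambda>x. x + u) ` e) ` E"
      by (simp_all add: image_image add.assoc)
    then show ?thesis using that by (simp add: P_def)
  qed
  have P_minus: "P (- u)" if "P u" for u
  proof -
    have "(\<lambda>x. x + - u) ` (\<lambda>x. x + u) ` V = V"
      "(\<lambda>e. (\<lambda>x. x + - u) ` e) ` (\<lambda>e. (\<lambda>x. x + u) ` e) ` E = E"
      by (simp_all add: image_image)
    then show ?thesis using that by (simp only: P_def)
  qed
  have P_0: "P 0" by (simp add: P_def)
  have P_a: "P (a r)" for r using periodic by (simp add: P_def periodic_graph_def is_periods_def)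
  have P_int: "P (of_int k *\<^sub>R a r)" for k r
  proof (induction k rule: int_induct[where k = 0])
    case (step1 i)
    then show ?case using P_add[OF step1(2) P_a[of r]] by (simp add: scaleR_left_distrib)
  next
    case (step2 i)
    then show ?case using P_add[OF step2(2) P_minus[OF P_a[of r]]]
        by (simp add: scaleR_left_diff_distrib)
  qed (simp add: P_0)
  have "P (\<Sum>r\<in>S. of_int (m $ r) *\<^sub>R a r)" if "finite S" for S
    using that by (induction S) (auto simp: P_0 P_int intro: P_add)
  then have "P (lat m)" by (simp add: lattice_vec_def)
  then show "(\<lambda>x. x + lat m) ` V = V" "(\<lambda>e. (\<lambda>x. x + lat m) ` e) ` E = E" by (simp_all add: P_def)
qed

lemma V_translate: "v + lat m \<in> V \<longleftrightarrow> v \<in> V"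
  using translate_lat(1)[of m] by (metis (no_types, lifting) add_right_cancel imageE imageI)

lemma coords_eqI:
  assumes "x = orig + (\<Sum>r\<in>UNIV. (c $ r) *\<^sub>R a r)"
  shows "coords a orig x = c"
  unfolding coords_def
proof (rule the_equality)
  show "x = orig + (\<Sum>r\<in>UNIV. (c $ r) *\<^sub>R a r)" by (rule assms)
  fix c' assume "x = orig + (\<Sum>r\<in>UNIV. (c' $ r) *\<^sub>R a r)"
  then have "(\<Sum>r\<in>UNIV. (c' $ r - c $ r) *\<^sub>R a r) = 0"
    using assms by (simp add: scaleR_left_diff_distrib sum_subtractf)
  \<comment> \<open>Independence speaks of the set \<open>range a\<close>; injectivity of
    \<open>a\<close> carries the sum over indices to a sum over that set.\<close>
  then have z: "(\<Sum>v\<in>range a. (c' $ inv_into UNIV a v - c $ inv_into UNIV a v) *\<^sub>R v) = 0"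
    using basis(1) by (simp add: sum.reindex)
  have "c' $ inv_into UNIV a (a r) - c $ inv_into UNIV a (a r) = 0" for r
    by (rule independentD[OF basis(2) _ _ z]) auto
  then show "c' = c" using basis(1) by (simp add: Finite_Cartesian_Product.vec_eq_iff)
qed

lemma coords_expand: "x = orig + (\<Sum>r\<in>UNIV. (coords a orig x $ r) *\<^sub>R a r)"
proof -
  have "x - orig \<in> span (range a)" using basis(3) by simp
  then obtain u where "x - orig = (\<Sum>v\<in>range a. u v *\<^sub>R v)"
    unfolding span_finite[OF finite_imageI[OF finite_class.finite_UNIV]] by blast
  then have "x - orig = (\<Sum>r\<in>UNIV. u (a r) *\<^sub>R a r)"
    using basis(1) by (simp only: sum.reindex o_def)
  then have x: "x = orig + (\<Sum>r\<in>UNIV. ((\<chi> r. u (a r)) $ r) *\<^sub>R a r)"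
    by (simp add: diff_eq_eq add.commute)
  show ?thesis by (subst coords_eqI[OF x]) (rule x)
qed

lemma coords_translate: "coords a orig (x + lat m) = coords a orig x + (\<chi> r. of_int (m $ r))"
proof (rule coords_eqI)
  have "x + lat m = orig + (\<Sum>r\<in>UNIV. (coords a orig x $ r) *\<^sub>R a r) + lat m"
    by (subst (1) coords_expand[of x]) (rule refl)
  then show "x + lat m = orig + (\<Sum>r\<in>UNIV. ((coords a orig x + (\<chi> r. of_int (m $ r))) $ r) *\<^sub>R a r)"
    by (simp add: lattice_vec_def scaleR_left_distrib sum.distrib)
qed

abbreviation ip :: "real ^ 'd \<Rightarrow> int ^ 'd" where "ip \<equiv> int_part a orig"
abbreviation fp :: "real ^ 'd \<Rightarrow> real ^ 'd" where "fp \<equiv> frac_part a orig"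

lemma int_part_translate: "ip (x + lat m) = ip x + m"
  by (simp add: int_part_def coords_translate Finite_Cartesian_Product.vec_eq_iff)

lemma frac_part_translate: "fp (x + lat m) = fp x"
  by (simp add: frac_part_def int_part_translate lattice_vec_add)

lemma frac_int_part: "fp x + lat (ip x) = x"
  by (simp add: frac_part_def)

lemma fund_verts_parts:
  assumes "v \<in> fund_verts V a orig"
  shows "ip v = 0" "fp v = v"
proof -
  show "ip v = 0" using assms by (auto simp: int_part_def
      fund_verts_def Finite_Cartesian_Product.vec_eq_iff floor_eq_iff)
  then show "fp v = v" by (simp add: frac_part_def)
qed

lemma frac_part_in_fund_verts:
  assumes "v \<in> V"
  shows "fp v \<in> fund_verts V a orig"
proof -
  have "fp v = v + lat (- ip v)" by (simp add: frac_part_def lattice_vec_minus)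
  moreover have "coords a orig (v + lat (- ip v)) $ r = frac (coords a orig v $ r)" for r
    unfolding coords_translate by (simp add: int_part_def frac_def)
  ultimately show ?thesis using assms V_translate by (simp add: fund_verts_def frac_lt_1)
qed

lemma oedges_iff: "(e, u, w, b) \<in> oedges V E \<longleftrightarrow> e \<in> E \<and> e \<inter> V = {u, w} \<and> (b \<longrightarrow> u = w)"
  by (simp add: oedges_def)

lemma oedges_D:
  assumes "x \<in> oedges V E"
  shows "osrc x \<in> V" "otgt x \<in> V"
proof -
  obtain e u w b where x: "x = (e, u, w, b)" by (cases x)
  then have "e \<inter> V = {u, w}" using assms by (simp add: oedges_iff)
  then have "u \<in> V" "w \<in> V" by blast+
  then show "osrc x \<in> V" "otgt x \<in> V" by (simp_all add: x)
qed

lemma orev_oedges: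
  assumes "x \<in> oedges V E"
  shows "orev x \<in> oedges V E"
proof -
  obtain e u w b where x: "x = (e, u, w, b)" by (cases x)
  have "{u, w} = {w, u}" by (rule insert_commute)
  then show ?thesis using assms by (simp add: x oedges_iff)
qed

lemma otranslate_oedges:
  assumes "x \<in> oedges V E"
  shows "otranslate (lat m) x \<in> oedges V E"
proof -
  obtain e u w b where x: "x = (e, u, w, b)" by (cases x)
  then have e: "e \<in> E" "e \<inter> V = {u, w}" "b \<longrightarrow> u = w" using assms by (simp_all add: oedges_iff)
  have "(\<lambda>x. x + lat m) ` e \<inter> V = (\<lambda>x. x + lat m) ` e \<inter> (\<lambda>x. x + lat m) ` V"
    by (simp only: translate_lat(1))
  also have "\<dots> = (\<lambda>x. x + lat m) ` (e \<inter> V)" by (subst image_Int) (auto simp: inj_def)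
  also have "\<dots> = {u + lat m, w + lat m}" using e by simp
  finally have "(\<lambda>x. x + lat m) ` e \<inter> V = {u + lat m, w + lat m}" .
  moreover have "(\<lambda>x. x + lat m) ` e \<in> E" using translate_lat(2)[of m] e(1) by blast
  ultimately show ?thesis using e(3) by (simp add: x oedges_iff)
qed

lemma oindex_orev: "oindex a orig (orev x) = - oindex a orig x"
  by (simp add: oindex_def)

lemma fsrc_oorbit: "fsrc a orig (oorbit a x) = fp (osrc x)"
  and ftgt_oorbit: "ftgt a orig (oorbit a x) = fp (otgt x)"
  and findex_oorbit: "findex a orig (oorbit a x) = oindex a orig x"
  by (auto simp: fsrc_def ftgt_def findex_def oorbit_def image_image frac_part_translate
      oindex_def int_part_translate)

text \<open>A translation is determined by what it does to the source, so each orbit whose source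
  class is \<open>fp v\<close> contains exactly one oriented edge starting at
  \<open>v\<close>.\<close>

lemma bij_betw_oorbit:
  assumes "v \<in> V"
  shows "bij_betw (oorbit a) {x \<in> oedges V E. osrc x = v} {c \<in> fund_oedges V E a. fsrc a orig c
      = fp v}"
  unfolding bij_betw_def
proof (intro conjI inj_onI equalityI subsetI)
  fix x y assume xy: "x \<in> {x \<in> oedges V E. osrc x = v}" "y \<in> {x \<in> oedges V E. osrc x = v}"
    and "oorbit a x = oorbit a y"
  then have "y \<in> oorbit a x" using oorbit_refl by blast
  then obtain m where "y = otranslate (lat m) x" by (auto simp: oorbit_def)
  with xy show "x = y" by auto
next
  fix c assume "c \<in> oorbit a ` {x \<in> oedges V E. osrc x = v}"
  then show "c \<in> {c \<in> fund_oedges V E a. fsrc a orig c = fp v}"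
    by (auto simp: fund_oedges_def fsrc_oorbit)
next
  fix c assume "c \<in> {c \<in> fund_oedges V E a. fsrc a orig c = fp v}"
  then obtain y where y: "y \<in> oedges V E" "c = oorbit a y" "fp (osrc y) = fp v"
    by (auto simp: fund_oedges_def fsrc_oorbit)
  \<comment> \<open>The translation that moves the source of \<open>y\<close> into the cell of
    \<open>v\<close>.\<close>
  define x where "x = otranslate (lat (ip v - ip (osrc y))) y"
  have "osrc x = fp (osrc y) + lat (ip v)"
    using frac_int_part[of "osrc y"] by (simp add: x_def lattice_vec_diff algebra_simps)
  then have "osrc x = v" using y(3) frac_int_part[of v] by simp
  moreover have "x \<in> oedges V E" "oorbit a x = c"
    using y by (simp_all add: x_def otranslate_oedges oorbit_otranslate)
  ultimately show "c \<in> oorbit a ` {x \<in> oedges V E. osrc x = v}" by blast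
qed

lemma edge_verts:
  assumes "e \<in> E"
  shows "\<exists>u w. e \<inter> V = {u, w}"
proof -
  have "edge_curve V e" using periodic assms by (simp add: periodic_graph_def)
  then show ?thesis unfolding edge_curve_def by blast
qed

text \<open>The flag separates the two summands of \<open>degree_at\<close>: with
  \<open>False\<close> every edge at \<open>v\<close> occurs once, with \<open>True\<close> every
  loop occurs once more.\<close>

lemma oedges_at:
  assumes "v \<in> V"
  shows "finite {x \<in> oedges V E. osrc x = v}" "card {x \<in> oedges V E. osrc x = v} = degree_at V E v"
proof -
  let ?S = "\<lambda>b. {x \<in> oedges V E. osrc x = v \<and> snd (snd (snd x)) = b}"
  have fin: "finite {e \<in> E. v \<in> e}" using periodic assms by (auto simp: periodic_graph_def)
  have mem: "(e, u, w, b) \<in> ?S b' \<longleftrightarrow> e \<in> E \<and> e \<inter> V = {u, w} \<and> (b \<longrightarrow> u = w) \<and> u = v \<and> b = b'" for e u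
      w b b'
    by (simp add: oedges_iff)
  have inj: "inj_on fst (?S b)" for b
  proof (rule inj_onI)
    fix x y assume xy: "x \<in> ?S b" "y \<in> ?S b" "fst x = fst y"
    obtain e u w c where x: "x = (e, u, w, c)" by (cases x)
    obtain e' u' w' c' where y: "y = (e', u', w', c')" by (cases y)
    have "u = v" "u' = v" "c = b" "c' = b" "e' = e" "e \<inter> V = {v, w}" "e \<inter> V = {v, w'}"
      using xy unfolding x y mem by simp_all
    then have "{v, w} = {v, w'}" by (simp only:)
    then have "w = w'" by (metis doubleton_eq_iff)
    then show "x = y" unfolding x y by (simp add: \<open>u = v\<close> \<open>u' = v\<close> \<open>c = b\<close> \<open>c' = b\<close> \<open>e' = e\<close>)
  qed
  have F: "bij_betw fst (?S False) {e \<in> E. v \<in> e}"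
    unfolding bij_betw_def
  proof (intro conjI inj equalityI subsetI)
    fix e assume "e \<in> fst ` ?S False"
    then obtain u w b where "(e, u, w, b) \<in> ?S False" by force
    then show "e \<in> {e \<in> E. v \<in> e}" unfolding mem by blast
  next
    fix e assume "e \<in> {e \<in> E. v \<in> e}"
    then have e: "e \<in> E" "v \<in> e \<inter> V" using assms by auto
    then obtain p q where pq: "e \<inter> V = {p, q}" using edge_verts by blast
    then have "v = p \<or> v = q" using e(2) by blast
    then obtain w where "e \<inter> V = {v, w}" using pq insert_commute[of p q "{}"] by metis
    then have "(e, v, w, False) \<in> ?S False" unfolding mem using e by simp
    then show "e \<in> fst ` ?S False" by (rule rev_image_eqI) simp
  qed
  have T: "bij_betw fst (?S True) {e \<in> E. e \<inter> V = {v}}"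
    unfolding bij_betw_def
  proof (intro conjI inj equalityI subsetI)
    fix e assume "e \<in> fst ` ?S True"
    then obtain u w b where "(e, u, w, b) \<in> ?S True" by force
    then have "e \<in> E" "e \<inter> V = {v}" unfolding mem by auto
    then show "e \<in> {e \<in> E. e \<inter> V = {v}}" by blast
  next
    fix e assume "e \<in> {e \<in> E. e \<inter> V = {v}}"
    then have "(e, v, v, True) \<in> ?S True" unfolding mem by simp
    then show "e \<in> fst ` ?S True" by (rule rev_image_eqI) simp
  qed
  have "finite {e \<in> E. e \<inter> V = {v}}" by (rule finite_subset[OF _ fin]) auto
  then have fins: "finite (?S False)" "finite (?S True)"
    using fin bij_betw_finite[OF F] bij_betw_finite[OF T] by simp_all
  have split: "{x \<in> oedges V E. osrc x = v} = ?S False \<union> ?S True" by auto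
  show "finite {x \<in> oedges V E. osrc x = v}" unfolding split using fins by simp
  show "card {x \<in> oedges V E. osrc x = v} = degree_at V E v"
    unfolding split degree_at_def using fins bij_betw_same_card[OF F] bij_betw_same_card[OF T]
    by (subst card_Un_disjoint) auto
qed

end

section \<open>Enumerated vertices and the passage to the quotient graph\<close>

locale loop_graph_enum = periodic_graph_origin V E a orig
  for V :: "(real ^ 'd) set" and E :: "(real ^ 'd) set set" and a :: "'d \<Rightarrow> real ^ 'd"
    and orig :: "real ^ 'd" +
  fixes Q :: "real ^ 'd \<Rightarrow> real" and vs :: "(real ^ 'd) list"
  assumes loops: "\<forall>c\<in>bridges V E a orig. fsrc a orig c = ftgt a orig c"
    and potential: "periodic_potential V a Q"
    and distinct: "distinct vs" and set_vs: "set vs = fund_verts V a orig"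
begin

definition vidx :: "real ^ 'd \<Rightarrow> nat" where "vidx v = (THE j. j < length vs \<and> vs ! j = v)"

lemma vidx_nth: "j < length vs \<Longrightarrow> vidx (vs ! j) = j"
  unfolding vidx_def using distinct by (auto simp: nth_eq_iff_index_eq)

lemma vidx: 
  assumes "v \<in> fund_verts V a orig"
  shows "vidx v < length vs" "vs ! vidx v = v"
  using assms unfolding set_vs[symmetric] in_set_conv_nth by (auto simp: vidx_nth)

lemma fund_oedges_D:
  assumes "c \<in> fund_oedges V E a"
  shows "fsrc a orig c \<in> fund_verts V a orig" "ftgt a orig c \<in> fund_verts V a orig"
    "orev ` c \<in> fund_oedges V E a" "orev ` orev ` c = c" "fsrc a orig (orev ` c) = ftgt a orig c"
    "findex a orig (orev ` c) = - findex a orig c"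
proof -
  obtain x where x: "x \<in> oedges V E" "c = oorbit a x" using assms by (auto simp: fund_oedges_def)
  show "fsrc a orig c \<in> fund_verts V a orig" "ftgt a orig c \<in> fund_verts V a orig"
    using x oedges_D[OF x(1)] by (simp_all add: fsrc_oorbit ftgt_oorbit frac_part_in_fund_verts)
  show "orev ` c \<in> fund_oedges V E a" using x orev_oedges
      by (auto simp: orev_oorbit fund_oedges_def)
  show "orev ` orev ` c = c" by (simp add: image_image)
  show "fsrc a orig (orev ` c) = ftgt a orig c" "findex a orig (orev ` c) = - findex a orig c"
    using x by (simp_all add: orev_oorbit fsrc_oorbit ftgt_oorbit findex_oorbit oindex_orev)
qed

text \<open>Orbits are sorted by their source: \<open>vs\<close> is a finite list, and at each
  vertex the orbits correspond to the finitely many oriented edges starting there.\<close>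

lemma finite_fund_oedges: "finite (fund_oedges V E a)"
proof -
  have "fund_oedges V E a = (\<Union>v\<in>set vs. {c \<in> fund_oedges V E a. fsrc a orig c = v})"
    using fund_oedges_D(1) set_vs by auto
  moreover have "finite {c \<in> fund_oedges V E a. fsrc a orig c = v}" if "v \<in> set vs" for v
  proof -
    have "v \<in> fund_verts V a orig" using that set_vs by simp
    then have "v \<in> V" "fp v = v" using fund_verts_parts by (auto simp: fund_verts_def)
    then show ?thesis using bij_betw_finite[OF bij_betw_oorbit[of v]] oedges_at(1)[of v] by simp
  qed
  ultimately show ?thesis by (metis (no_types, lifting) finite_UN finite_set)
qed

sublocale qg: quotient_graph "length vs" "fund_oedges V E a" "\<lambda>c. vidx (fsrc a orig c)"
  "\<lambda>c. vidx (ftgt a orig c)" "findex a orig" "(`) orev" "\<lambda>j. real (degree_at V E (vs ! j))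
      + Q (vs ! j)"
proof
  fix c assume "c \<in> fund_oedges V E a" "findex a orig c \<noteq> 0"
  then show "vidx (fsrc a orig c) = vidx (ftgt a orig c)" using loops by (simp add: bridges_def)
qed (simp_all add: finite_fund_oedges fund_oedges_D vidx)

lemma Br_bridges: "qg.Br = bridges V E a orig"
  by (simp add: qg.Br_def bridges_def)

lemma vidx_eq_iff: "v \<in> fund_verts V a orig \<Longrightarrow> j < length vs \<Longrightarrow> vidx v = j \<longleftrightarrow> v = vs ! j"
  using vidx vidx_nth by auto

lemma floquet_matrix_floq:
  "floquet_matrix V E a orig Q vs \<theta> = mat (length vs) (length vs) (\<lambda>(j, k). qg.floq \<theta> j k)"
proof -
  have "{c \<in> fund_oedges V E a. fsrc a orig c = vs ! j \<and> ftgt a orig c = vs ! k}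
    = {c \<in> fund_oedges V E a. vidx (fsrc a orig c) = j \<and> vidx (ftgt a orig c) = k}"
    if "j < length vs" "k < length vs" for j k
    using that by (intro Collect_cong conj_cong refl) (simp_all add: vidx_eq_iff fund_oedges_D)
  then show ?thesis
    unfolding floquet_matrix_def by (intro cong_mat) (auto simp: qg.floq_def)
qed

lemma band_fun_ev: "band_fun V E a orig Q vs n \<theta> = qg.ev (n - 1) \<theta>"
  by (simp add: band_fun_def floquet_matrix_floq qg.ev_def eigs_def)

lemma band_ev: "band V E a orig Q vs n = range (qg.ev (n - 1))"
  by (simp add: band_def band_fun_ev)

definition vert :: "(int ^ 'd) \<times> nat \<Rightarrow> real ^ 'd" where
  "vert = (\<lambda>(m, j). vs ! j + lat m)"

lemma nth_fund_verts: "j < length vs \<Longrightarrow> vs ! j \<in> fund_verts V a orig"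
  using set_vs nth_mem by blast

lemma vert_parts: "j < length vs \<Longrightarrow> ip (vert (m, j)) = m" "j < length vs \<Longrightarrow> fp (vert (m, j)) = vs ! j"
  using fund_verts_parts[OF nth_fund_verts]
    by (simp_all add: vert_def int_part_translate frac_part_translate)

lemma vert_in_V: "j < length vs \<Longrightarrow> vert (m, j) \<in> V"
  using nth_fund_verts[of j] by (simp add: vert_def V_translate fund_verts_def)

lemma vert_vidx: "v \<in> V \<Longrightarrow> vert (ip v, vidx (fp v)) = v"
  using vidx(2)[OF frac_part_in_fund_verts] by (simp add: vert_def frac_int_part)

lemma bij_betw_vert: "bij_betw vert (cells (length vs)) V"
  by (rule bij_betw_byWitness[where f' = "\<lambda>v. (ip v, vidx (fp v))"])
    (auto simp: vert_parts vidx_nth vert_vidx vert_in_V vidx frac_part_in_fund_verts)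

text \<open>The oriented edges leaving a vertex correspond to the orbits with that source class, so
  the sum over neighbours becomes a sum over orbits; the index tells the cell of the far end
  point.\<close>

lemma schroedinger_vert:
  assumes "i \<in> cells (length vs)"
  shows "schroedinger V E Q f (vert i) = qg.lattice_op (pull (cells (length vs)) vert f) i"
proof -
  obtain m j where i: "i = (m, j)" by (cases i)
  have j: "j < length vs" using assms i by simp
  let ?v = "vert (m, j)" and ?X = "{c \<in> fund_oedges V E a. vidx (fsrc a orig c) = j}"
  have v: "?v \<in> V" by (rule vert_in_V[OF j])
  have u: "vs ! j \<in> V" "fp (vs ! j) = vs ! j"
    using nth_fund_verts[OF j] fund_verts_parts by (auto simp: fund_verts_def)
  have X: "?X = {c \<in> fund_oedges V E a. fsrc a orig c = vs ! j}"
    using j fund_oedges_D(1) vidx_eq_iff by auto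
  have bij: "bij_betw (oorbit a) {x \<in> oedges V E. osrc x = ?v} ?X"
    using bij_betw_oorbit[OF v] unfolding X vert_parts(2)[OF j] .
  \<comment> \<open>The degree is constant along translates: both edge sets are in bijection with
    the same set of orbits.\<close>
  have card: "card {x \<in> oedges V E. osrc x = ?v} = degree_at V E (vs ! j)"
    using bij_betw_same_card[OF bij] bij_betw_same_card[OF bij_betw_oorbit[OF u(1)]]
      oedges_at(2)[OF u(1)]
    unfolding X u(2) by simp
  have "(\<Sum>x\<in>{x \<in> oedges V E. osrc x = ?v}. f (otgt x))
    = (\<Sum>x\<in>{x \<in> oedges V E. osrc x = ?v}. f (vert (m + findex a orig (oorbit a x), vidx (ftgt a
        orig (oorbit a x)))))"
  proof (intro sum.cong refl)
    fix x assume x: "x \<in> {x \<in> oedges V E. osrc x = ?v}"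
    then have "m + findex a orig (oorbit a x) = ip (otgt x)"
      using vert_parts(1)[OF j] by (simp add: findex_oorbit oindex_def)
    then show "f (otgt x) = f (vert (m
        + findex a orig (oorbit a x), vidx (ftgt a orig (oorbit a x))))"
      using x oedges_D(2) by (simp add: ftgt_oorbit vert_vidx)
  qed
  also have "\<dots> = (\<Sum>c\<in>?X. f (vert (m + findex a orig c, vidx (ftgt a orig c))))"
    by (rule sum.reindex_bij_betw[OF bij])
  finally have sum: "(\<Sum>x\<in>{x \<in> oedges V E. osrc x = ?v}. f (otgt x))
    = (\<Sum>c\<in>?X. f (vert (m + findex a orig c, vidx (ftgt a orig c))))" .
  have "Q ?v = Q (vs ! j)" using potential u(1) by (simp add: periodic_potential_def vert_def)
  then have "schroedinger V E Q f ?v = of_real (real (degree_at V E (vs ! j)) + Q (vs ! j)) * f ?v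
    - (\<Sum>c\<in>?X. f (vert (m + findex a orig c, vidx (ftgt a orig c))))"
    using v by (simp add: schroedinger_def laplacian_def sum_subtractf card sum algebra_simps)
  moreover have "(\<Sum>c\<in>?X. f (vert (m + findex a orig c, vidx (ftgt a orig c))))
    = (\<Sum>c\<in>?X. pull (cells (length vs)) vert f (m + findex a orig c, vidx (ftgt a orig c)))"
    using fund_oedges_D(2) vidx(1) by (intro sum.cong refl) (simp add: pull_def)
  ultimately show ?thesis using j unfolding i by (simp add: qg.lattice_op_def pull_def)
qed

lemma schroedinger_spectrum_eq:
  "schroedinger_spectrum V E Q = {x. of_real x \<in> ell2_spectrum (cells (length vs)) qg.lattice_op}"
proof -
  have "ell2_spectrum V (schroedinger V E Q) = ell2_spectrum (cells (length vs)) qg.lattice_op"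
  proof (rule ell2_spectrum_transfer[OF bij_betw_vert])
    show "schroedinger V E Q f (vert i) = qg.lattice_op (pull (cells (length vs)) vert f) i"
      if "i \<in> cells (length vs)" for f i using that by (rule schroedinger_vert)
  qed (auto simp: schroedinger_def qg.lattice_op_def split: if_splits)
  then show ?thesis by (simp add: schroedinger_spectrum_def)
qed

end

lemma sum_from_1_lessThan: "(\<Sum>n=1..N. f (n - 1)) = (\<Sum>i<N. f i)"
  for f :: "nat \<Rightarrow> 'a::comm_monoid_add"
  by (rule sum.reindex_bij_witness[of _ Suc "\<lambda>n. n - 1"]) auto

theorem theorem2p4:
  fixes V :: "(real ^ 'd) set" and E :: "(real ^ 'd) set set"
    and a :: "'d \<Rightarrow> real ^ 'd" and orig :: "real ^ 'd"
    and Q :: "real ^ 'd \<Rightarrow> real" and vs :: "(real ^ 'd) list"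
  assumes "CARD('d) \<ge> 2"
    and "loop_fundamental_graph V E a orig"
    and "periodic_potential V a Q"
    and "distinct vs" and "set vs = fund_verts V a orig"
  defines "\<nu> \<equiv> length vs"
    and "ev \<equiv> band_fun V E a orig Q vs"
    and "\<sigma> \<equiv> band V E a orig Q vs"
    and "\<beta> \<equiv> card (bridges V E a orig)"
  shows "(\<forall>n\<in>{1..\<nu>}. \<sigma> n = {Inf (\<sigma> n)..Sup (\<sigma> n)} \<and> Inf (\<sigma> n) = ev n 0) \<and>
    (\<forall>\<theta>\<^sub>0. precise_quasimomentum V E a orig \<theta>\<^sub>0 \<longrightarrow>
       (\<forall>n\<in>{1..\<nu>}. \<sigma> n = {Inf (\<sigma> n)..Sup (\<sigma> n)} \<and>
          Inf (\<sigma> n) = ev n 0 \<and> Sup (\<sigma> n) = ev n \<theta>\<^sub>0) \<and>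
       (\<Sum>n=1..\<nu>. measure lebesgue (\<sigma> n)) = 2 * real \<beta> \<and>
       ((\<exists>v\<in>fund_verts V a orig. \<forall>c\<in>bridges V E a orig.
            fsrc a orig c = v \<and> ftgt a orig c = v) \<longrightarrow>
          measure lebesgue (schroedinger_spectrum V E Q) = (\<Sum>n=1..\<nu>. measure lebesgue (\<sigma> n)) \<and>
          (\<Sum>n=1..\<nu>. measure lebesgue (\<sigma> n)) = 2 * real \<beta>))"
proof -
  interpret loop_graph_enum V E a orig Q vs
    using assms(2-5) by unfold_locales (auto simp: loop_fundamental_graph_def)
  have \<sigma>: "\<sigma> n = range (qg.ev (n - 1))" and ev: "ev n \<theta> = qg.ev (n - 1) \<theta>" for n \<theta>
    by (simp_all add: \<sigma>_def ev_def band_ev band_fun_ev)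
  have part1: "\<sigma> n = {Inf (\<sigma> n)..Sup (\<sigma> n)} \<and> Inf (\<sigma> n) = ev n 0" if "n \<in> {1..\<nu>}" for n
  proof -
    \<comment> \<open>Bands are numbered from 1, \<open>qg.ev\<close> from 0.\<close>
    have "n - 1 < length vs" using that by (auto simp: \<nu>_def)
    then show ?thesis unfolding \<sigma> ev using qg.band_interval(1) qg.Inf_band by blast
  qed
  have total: "(\<Sum>n=1..\<nu>. measure lebesgue (\<sigma> n))
      = (\<Sum>i<length vs. measure lebesgue (range (qg.ev i)))"
    unfolding \<sigma> \<nu>_def by (rule sum_from_1_lessThan)
  show ?thesis
  proof (intro conjI ballI allI impI)
    fix \<theta>\<^sub>0 assume "precise_quasimomentum V E a orig \<theta>\<^sub>0"
    then have precise: "cos (pairing (findex a orig c) \<theta>\<^sub>0) = -1" if "c \<in> qg.Br" for c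
      using that by (simp add: precise_quasimomentum_def Br_bridges)
    show Sup: "Sup (\<sigma> n) = ev n \<theta>\<^sub>0" if "n \<in> {1..\<nu>}" for n
      unfolding \<sigma> ev using that precise by (intro qg.Sup_band) (auto simp: \<nu>_def)
    show sum: "(\<Sum>n=1..\<nu>. measure lebesgue (\<sigma> n)) = 2 * real \<beta>"
      unfolding total using qg.sum_measure_bands[OF precise] by (simp add: \<beta>_def Br_bridges)
    then show "(\<Sum>n=1..\<nu>. measure lebesgue (\<sigma> n)) = 2 * real \<beta>" .
    assume "\<exists>v\<in>fund_verts V a orig. \<forall>c\<in>bridges V E a orig. fsrc a orig c = v \<and> ftgt a orig c = v"
    then obtain v where v: "v \<in> fund_verts V a orig"
      and bridges: "\<And>c. c \<in> qg.Br \<Longrightarrow> vidx (fsrc a orig c) = vidx v"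
      unfolding Br_bridges by auto
    \<comment> \<open>Preciseness and the common vertex of the bridges enter through the inclusion
      of the spectrum in the bands; the opposite inclusion comes from the Bloch waves.\<close>
    have "schroedinger_spectrum V E Q = (\<Union>i<length vs. range (qg.ev i))"
    proof (intro equalityI subsetI)
      fix x assume "x \<in> schroedinger_spectrum V E Q"
      then show "x \<in> (\<Union>i<length vs. range (qg.ev i))"
        using qg.spectrum_subset_bands[OF precise bridges vidx(1)[OF v]]
        unfolding schroedinger_spectrum_eq by blast
    next
      fix x assume "x \<in> (\<Union>i<length vs. range (qg.ev i))"
      then show "x \<in> schroedinger_spectrum V E Q"
        unfolding schroedinger_spectrum_eq using qg.band_subset_spectrum by auto
    qed
    then show "measure lebesgue (schroedinger_spectrum V E Q) = (\<Sum>n=1..\<nu>. measure lebesgue (\<sigma> n))"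
      unfolding total using qg.measure_Union_bands[OF precise bridges vidx(1)[OF v]] by simp
  qed (use part1 in blast)+
qed

end
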